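(* For every partition $\lambda\vdash n$, \[ \sum_{\mathcal{T}\in\mathrm{SYT}_\pm(\lambda)} q^{\operatorname{maj}(\mathcal{T})}t^{\operatorname{neg}(\mathcal{T})}=[n]_q!\prod_{(r,c)\in\lambda}\frac{q^{r-1}+tq^{c-1}}{[h(r,c)]_q}, \] where $[k]_q=1+q+\cdots+q^{k-1}$ and $[n]_q!=[1]_q[2]_q\cdots[n]_q$.
   Context: Partitions are drawn in English notation; $(r,c)\in\lambda$ denotes the cell in row $r$, column $c$, and $h(r,c)$ is its hook length (number of cells weakly to the right in its row plus weakly below in its column, counting the cell once). $\mathrm{SYT}_\pm(\lambda)$ is the set of standard Young tableaux of shape $\lambda$ (entries $1,\dots,n$) with each cell marked positive or negative; $\mathrm{Neg}(\mathcal{T})$ is the set of entries in negative cells, $\operatorname{neg}(\mathcal{T})=|\mathrm{Neg}(\mathcal{T})|$. $\mathrm{Des}(\mathcal{T})$ is the set of $i\in[n-1]$ such that either ($i+1\notin\mathrm{Neg}(\mathcal{T})$ and $i+1$ is in a strictly lower row than $i$) or ($i\in\mathrm{Neg}(\mathcal{T})$ and $i+1$ is not in a strictly lower row than $i$); $\operatorname{maj}(\mathcal{T})=\sum_{i\in\mathrm{Des}(\mathcal{T})}i$. *)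

theory Defs
  imports Main
begin

definition is_partition :: "nat list \<Rightarrow> nat \<Rightarrow> bool" where
  "is_partition lam n \<longleftrightarrow> sorted_wrt (\<ge>) lam \<and> (\<forall>x\<in>set lam. 0 < x) \<and> sum_list lam = n"

text \<open>Cells (r,c), 1-based, English notation.\<close>
definition cells :: "nat list \<Rightarrow> (nat \<times> nat) set" where
  "cells lam = {(r, c). 1 \<le> r \<and> r \<le> length lam \<and> 1 \<le> c \<and> c \<le> lam ! (r - 1)}"

definition hook :: "nat list \<Rightarrow> nat \<times> nat \<Rightarrow> nat" where
  "hook lam x = (case x of (r, c) \<Rightarrow>
      card {c'. (r, c') \<in> cells lam \<and> c \<le> c'} + card {r'. (r', c) \<in> cells lam \<and> r < r'})"

text \<open>Standard Young tableau of shape lam with entries 1..n; the filling is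
  taken to be 0 outside the diagram so that the set of tableaux is finite.\<close>
definition is_SYT :: "nat list \<Rightarrow> (nat \<times> nat \<Rightarrow> nat) \<Rightarrow> bool" where
  "is_SYT lam T \<longleftrightarrow>
     bij_betw T (cells lam) {1..sum_list lam} \<and>
     (\<forall>x. x \<notin> cells lam \<longrightarrow> T x = 0) \<and>
     (\<forall>r c. (r, c) \<in> cells lam \<and> (r, Suc c) \<in> cells lam \<longrightarrow> T (r, c) < T (r, Suc c)) \<and>
     (\<forall>r c. (r, c) \<in> cells lam \<and> (Suc r, c) \<in> cells lam \<longrightarrow> T (r, c) < T (Suc r, c))"

text \<open>Signed SYT: a SYT together with the set N of its negative cells.\<close>
definition signed_SYT :: "nat list \<Rightarrow> ((nat \<times> nat \<Rightarrow> nat) \<times> (nat \<times> nat) set) set" where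
  "signed_SYT lam = {(T, N). is_SYT lam T \<and> N \<subseteq> cells lam}"

definition Neg :: "(nat \<times> nat \<Rightarrow> nat) \<times> (nat \<times> nat) set \<Rightarrow> nat set" where
  "Neg TN = fst TN ` snd TN"

definition neg :: "(nat \<times> nat \<Rightarrow> nat) \<times> (nat \<times> nat) set \<Rightarrow> nat" where
  "neg TN = card (Neg TN)"

definition row_of :: "nat list \<Rightarrow> (nat \<times> nat \<Rightarrow> nat) \<Rightarrow> nat \<Rightarrow> nat" where
  "row_of lam T i = fst (THE x. x \<in> cells lam \<and> T x = i)"

definition Des :: "nat list \<Rightarrow> (nat \<times> nat \<Rightarrow> nat) \<times> (nat \<times> nat) set \<Rightarrow> nat set" where
  "Des lam TN = {i \<in> {1..sum_list lam - 1}.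
      (Suc i \<notin> Neg TN \<and> row_of lam (fst TN) i < row_of lam (fst TN) (Suc i)) \<or>
      (i \<in> Neg TN \<and> \<not> row_of lam (fst TN) i < row_of lam (fst TN) (Suc i))}"

definition maj :: "nat list \<Rightarrow> (nat \<times> nat \<Rightarrow> nat) \<times> (nat \<times> nat) set \<Rightarrow> nat" where
  "maj lam TN = \<Sum> (Des lam TN)"

definition qint :: "'a::comm_semiring_1 \<Rightarrow> nat \<Rightarrow> 'a" where
  "qint q k = (\<Sum>j<k. q ^ j)"

definition qfact :: "'a::comm_semiring_1 \<Rightarrow> nat \<Rightarrow> 'a" where
  "qfact q n = (\<Prod>k\<in>{1..n}. qint q k)"

end

theory Submission
  imports Defs "Jordan_Normal_Form.Char_Poly"
begin

text \<open>
  Removing from a signed tableau the cells that follow the last descent leaves a smaller shape: going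
  backwards one strips off a vertical strip of negative cells and then a horizontal strip of positive
  ones. After division by \<open>(1 - q) \<dots> (1 - q ^ n)\<close> the generating functions of all shapes therefore satisfy
  one recursion, and it remains to verify it for the hook products \<open>H\<close>. For these the two kinds of
  strips can be summed separately: horizontal strips turn \<open>H t\<close> into \<open>H (q t)\<close>, vertical strips turn
  \<open>H (q t)\<close> into \<open>H t\<close>. In terms of the numbers \<open>\<beta>\<^sub>i = \<lambda>\<^sub>i + L - 1 - i\<close> a hook product is a Vandermonde
  determinant in the \<open>q ^ \<beta>\<^sub>i\<close> times a product over the rows, so both identities become row and column
  operations on determinants. All this happens over the reals with \<open>0 < q < 1\<close> and \<open>t > 0\<close>, where no
  denominator vanishes; since the identity without denominators is one between integer polynomials in
  \<open>q\<close> and \<open>t\<close>, it then holds in every commutative ring.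
\<close>

section \<open>Recursion on the largest entry: corners, descents and generating functions\<close>

definition dec_row :: "(nat \<Rightarrow> nat) \<Rightarrow> nat \<Rightarrow> nat \<Rightarrow> nat" where
  "dec_row a i = a(i := a i - 1)"

definition corner_rows :: "(nat \<Rightarrow> nat) \<Rightarrow> nat set" where
  "corner_rows a = {i. a (Suc i) < a i}"

text \<open>A pair consists of the row of an entry and its sign, where \<open>True\<close> stands for negative.\<close>

definition desc :: "nat \<times> bool \<Rightarrow> nat \<times> bool \<Rightarrow> bool" where
  "desc y x \<longleftrightarrow> (\<not> snd x \<and> fst y < fst x) \<or> (snd y \<and> \<not> fst y < fst x)"

text \<open>
  \<open>last_gf q t n a x\<close> will be the sum of \<open>q ^ maj * t ^ neg\<close> over the signed tableaux of shape \<open>a\<close> and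
  size \<open>n\<close> in which the row and sign of the largest entry are given by \<open>x\<close>.
\<close>

primrec last_gf :: "'a::comm_semiring_1 \<Rightarrow> 'a \<Rightarrow> nat \<Rightarrow> (nat \<Rightarrow> nat) \<Rightarrow> nat \<times> bool \<Rightarrow> 'a" where
  "last_gf q t 0 a x = 0"
| "last_gf q t (Suc n) a x = (if snd x then t else 1) * ((if n = 0 then 1 else 0) +
     (\<Sum>y\<in>corner_rows (dec_row a (fst x)) \<times> UNIV.
        (if desc y x then q ^ n else 1) * last_gf q t n (dec_row a (fst x)) y))"

text \<open>The empty shape has no corner, so its single tableau is missed by the sum over the
  possible last entries and is counted by the separate value 1.\<close>

definition total_gf :: "'a::comm_semiring_1 \<Rightarrow> 'a \<Rightarrow> nat \<Rightarrow> (nat \<Rightarrow> nat) \<Rightarrow> 'a" where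
  "total_gf q t n a = (if n = 0 then 1 else \<Sum>x\<in>corner_rows a \<times> UNIV. last_gf q t n a x)"

lemma row_of_eq:
  assumes "inj_on T (cells lam)" "x \<in> cells lam"
  shows "row_of lam T (T x) = fst x"
proof -
  have "(THE y. y \<in> cells lam \<and> T y = T x) = x"
    using assms by (intro the_equality) (auto dest: inj_onD)
  then show ?thesis by (simp add: row_of_def)
qed

lemma finite_cells: "finite (cells lam)"
proof (rule finite_subset)
  show "cells lam \<subseteq> {..length lam} \<times> {..Max (set lam)}"
  proof (clarsimp simp: cells_def)
    fix r c assume "Suc 0 \<le> r" "r \<le> length lam" "c \<le> lam ! (r - Suc 0)"
    moreover from this have "lam ! (r - Suc 0) \<le> Max (set lam)" by (intro Max_ge) auto
    ultimately show "c \<le> Max (set lam)" by linarith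
  qed
qed auto

section \<open>Signed tableaux and removal of the largest entry\<close>

text \<open>
  A partition with at most \<open>L\<close> parts is a function on all row indices, counted from 0 and with value 0
  from \<open>L\<close> on, while the rows and columns of \<open>cells\<close> are counted from 1.
\<close>

locale row_bound =
  fixes L :: nat
begin

definition shape :: "(nat \<Rightarrow> nat) \<Rightarrow> bool" where
  "shape a \<longleftrightarrow> (\<forall>i. a (Suc i) \<le> a i) \<and> (\<forall>i\<ge>L. a i = 0)"

definition size :: "(nat \<Rightarrow> nat) \<Rightarrow> nat" where
  "size a = (\<Sum>i<L. a i)"

text \<open>Adding the staircase makes the first \<open>L\<close> parts of a shape strictly
  decreasing, hence usable as distinct exponents in a Vandermonde determinant.\<close>

definition beta :: "(nat \<Rightarrow> nat) \<Rightarrow> nat \<Rightarrow> nat" where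
  "beta a i = a i + (L - 1 - i)"

lemma shape_antimono: "shape a \<Longrightarrow> i \<le> j \<Longrightarrow> a j \<le> a i"
  unfolding shape_def by (metis lift_Suc_antimono_le)

lemma corner_rows_less: "shape a \<Longrightarrow> i \<in> corner_rows a \<Longrightarrow> i < L"
  unfolding shape_def corner_rows_def mem_Collect_eq by (metis not_less not_less_zero)

lemma finite_corner_rows: "shape a \<Longrightarrow> finite (corner_rows a)"
  using corner_rows_less by (intro finite_subset[of "corner_rows a" "{..<L}"]) auto

lemma shape_dec_row:
  assumes "shape a" "i \<in> corner_rows a"
  shows "shape (dec_row a i)"
  unfolding shape_def
proof (intro conjI allI impI)
  fix k
  have "a (Suc k) \<le> a k" "a (Suc i) < a i" using assms by (auto simp: shape_def corner_rows_def)
  then show "dec_row a i (Suc k) \<le> dec_row a i k" by (auto simp: dec_row_def)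
next
  fix k assume "L \<le> k"
  then show "dec_row a i k = 0" using assms corner_rows_less[OF assms] by (auto simp: dec_row_def shape_def)
qed

lemma size_dec_row:
  assumes "shape a" "i \<in> corner_rows a"
  shows "size a = Suc (size (dec_row a i))"
proof -
  have i: "i < L" "a i > 0" using corner_rows_less[OF assms] assms(2) by (auto simp: corner_rows_def)
  have "size a = a i + (\<Sum>k\<in>{..<L} - {i}. a k)"
    unfolding size_def using i by (subst sum.remove[of _ i]) auto
  moreover have "size (dec_row a i) = (a i - 1) + (\<Sum>k\<in>{..<L} - {i}. a k)"
    unfolding size_def using i by (subst sum.remove[of _ i]) (auto simp: dec_row_def intro!: sum.cong)
  ultimately show ?thesis using i by simp
qed

lemma beta_less:
  assumes "shape a" "i < j" "j < L"
  shows "beta a j < beta a i"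
  using shape_antimono[OF assms(1), of i j] assms(2,3) by (simp add: beta_def)

abbreviation row_list :: "(nat \<Rightarrow> nat) \<Rightarrow> nat list" where
  "row_list a \<equiv> map a [0..<L]"

lemma sum_row_list: "sum_list (row_list a) = size a"
  by (simp add: size_def sum_list_sum_nth atLeast0LessThan)

lemma cells_row_list:
  assumes "shape a"
  shows "(r, c) \<in> cells (row_list a) \<longleftrightarrow> 1 \<le> r \<and> 1 \<le> c \<and> c \<le> a (r - 1)"
proof (cases "r - 1 < L")
  case True
  then show ?thesis by (auto simp: cells_def)
next
  case False
  then have "a (r - 1) = 0" using assms by (simp add: shape_def)
  then show ?thesis using False by (auto simp: cells_def)
qed

lemma corner_in_cells: "shape a \<Longrightarrow> i \<in> corner_rows a \<Longrightarrow> (Suc i, a i) \<in> cells (row_list a)"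
  by (auto simp: cells_row_list corner_rows_def)

lemma cells_dec_row:
  assumes "shape a" "i \<in> corner_rows a"
  shows "cells (row_list (dec_row a i)) = cells (row_list a) - {(Suc i, a i)}"
proof -
  have "p \<in> cells (row_list (dec_row a i)) \<longleftrightarrow> p \<in> cells (row_list a) - {(Suc i, a i)}" for p
  proof -
    obtain r c where p: "p = (r, c)" by (cases p)
    show ?thesis
      unfolding p Diff_iff cells_row_list[OF assms(1)] cells_row_list[OF shape_dec_row[OF assms]]
      using assms(2) by (cases r) (auto simp: dec_row_def corner_rows_def)
  qed
  then show ?thesis by blast
qed

lemma neighbours_of_corner:
  assumes "shape a" "i \<in> corner_rows a"
  shows "(Suc i, Suc (a i)) \<notin> cells (row_list a)" "(Suc (Suc i), a i) \<notin> cells (row_list a)"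
  using assms by (auto simp: cells_row_list corner_rows_def)

lemma is_SYT_le:
  "is_SYT (row_list a) T \<Longrightarrow> y \<in> cells (row_list a) \<Longrightarrow> 1 \<le> T y \<and> T y \<le> size a"
  by (auto simp: is_SYT_def sum_row_list bij_betw_def)

lemma is_SYT_remove:
  assumes a: "shape a" "i \<in> corner_rows a" and T: "is_SYT (row_list a) T" "T (Suc i, a i) = size a"
  shows "is_SYT (row_list (dec_row a i)) (T((Suc i, a i) := 0))"
proof -
  have "bij_betw T (cells (row_list a) - {(Suc i, a i)}) ({1..size a} - {size a})"
    using T corner_in_cells[OF a] unfolding is_SYT_def sum_row_list
    using size_dec_row[OF a] by (intro bij_betw_DiffI) (auto simp: bij_betw_def)
  moreover have "{1..size a} - {size a} = {1..size (dec_row a i)}"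
    using size_dec_row[OF a] by auto
  ultimately have "bij_betw (T((Suc i, a i) := 0)) (cells (row_list (dec_row a i))) {1..size (dec_row a i)}"
    unfolding cells_dec_row[OF a] by (subst bij_betw_cong[where g = T]) auto
  then show ?thesis
    using T(1) unfolding is_SYT_def sum_row_list cells_dec_row[OF a] by auto
qed

lemma is_SYT_insert:
  assumes a: "shape a" "i \<in> corner_rows a" and T: "is_SYT (row_list (dec_row a i)) T"
  shows "is_SYT (row_list a) (T((Suc i, a i) := size a))"
proof -
  let ?x = "(Suc i, a i)" and ?c = "dec_row a i"
  have cells: "cells (row_list a) = insert ?x (cells (row_list ?c))" "?x \<notin> cells (row_list ?c)"
    using cells_dec_row[OF a] corner_in_cells[OF a] by auto
  have "bij_betw (T(?x := size a)) (cells (row_list ?c)) {1..size ?c}"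
    using T cells(2) unfolding is_SYT_def sum_row_list by (subst bij_betw_cong[where g = T]) auto
  then have "bij_betw (T(?x := size a)) (cells (row_list ?c) \<union> {?x}) ({1..size ?c} \<union> {size a})"
    using notIn_Un_bij_betw[of ?x "cells (row_list ?c)" "T(?x := size a)" "{1..size ?c}"] cells(2) size_dec_row[OF a]
    by simp
  moreover have "{1..size ?c} \<union> {size a} = {1..size a}" using size_dec_row[OF a] by auto
  ultimately have "bij_betw (T(?x := size a)) (cells (row_list a)) {1..size a}"
    using cells(1) by simp
  moreover have "T y < size a" if "y \<in> cells (row_list ?c)" for y
    using is_SYT_le[OF T that] size_dec_row[OF a] by simp
  ultimately show ?thesis
    using T cells(2) neighbours_of_corner[OF a]
    unfolding is_SYT_def sum_row_list cells(1) by auto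
qed

section \<open>Classification of signed tableaux by their largest entry\<close>

definition last_SYT :: "(nat \<Rightarrow> nat) \<Rightarrow> nat \<times> bool \<Rightarrow> ((nat \<times> nat \<Rightarrow> nat) \<times> (nat \<times> nat) set) set" where
  "last_SYT a x = {TN \<in> signed_SYT (row_list a). fst TN (Suc (fst x), a (fst x)) = size a \<and>
      ((Suc (fst x), a (fst x)) \<in> snd TN \<longleftrightarrow> snd x)}"

definition add_last :: "(nat \<Rightarrow> nat) \<Rightarrow> nat \<times> bool \<Rightarrow> (nat \<times> nat \<Rightarrow> nat) \<times> (nat \<times> nat) set
    \<Rightarrow> (nat \<times> nat \<Rightarrow> nat) \<times> (nat \<times> nat) set" where
  "add_last a x TN = ((fst TN)((Suc (fst x), a (fst x)) := size a),
     if snd x then insert (Suc (fst x), a (fst x)) (snd TN) else snd TN)"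

lemma sum_last_SYT:
  assumes a: "shape a" "i \<in> corner_rows a"
  shows "(\<Sum>TN\<in>last_SYT a (i, s). F TN) = (\<Sum>TN\<in>signed_SYT (row_list (dec_row a i)). F (add_last a (i, s) TN))"
\<comment> \<open>The emptied cell receives the value 0 because fillings vanish outside the
  diagram.\<close>
proof (rule sum.reindex_bij_witness[where i = "add_last a (i, s)"
        and j = "\<lambda>TN. ((fst TN)((Suc i, a i) := 0), snd TN - {(Suc i, a i)})"])
  fix TN assume TN: "TN \<in> last_SYT a (i, s)"
  show eq: "add_last a (i, s) ((fst TN)((Suc i, a i) := 0), snd TN - {(Suc i, a i)}) = TN"
    using TN by (cases TN) (auto simp: add_last_def last_SYT_def)
  show "((fst TN)((Suc i, a i) := 0), snd TN - {(Suc i, a i)}) \<in> signed_SYT (row_list (dec_row a i))"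
    using TN is_SYT_remove[OF a] by (auto simp: signed_SYT_def last_SYT_def cells_dec_row[OF a])
  show "F (add_last a (i, s) ((fst TN)((Suc i, a i) := 0), snd TN - {(Suc i, a i)})) = F TN"
    by (simp add: eq)
next
  fix TN assume TN: "TN \<in> signed_SYT (row_list (dec_row a i))"
  then have "(Suc i, a i) \<notin> snd TN" "fst TN (Suc i, a i) = 0"
    by (auto simp: signed_SYT_def cells_dec_row[OF a] is_SYT_def)
  then show "((fst (add_last a (i, s) TN))((Suc i, a i) := 0), snd (add_last a (i, s) TN) - {(Suc i, a i)}) = TN"
    by (cases TN) (auto simp: add_last_def)
  show "add_last a (i, s) TN \<in> last_SYT a (i, s)"
    using TN is_SYT_insert[OF a] corner_in_cells[OF a]
    by (auto simp: add_last_def last_SYT_def signed_SYT_def cells_dec_row[OF a])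
qed

lemma signed_SYT_last:
  assumes a: "shape a" and n: "size a > 0"
  shows "signed_SYT (row_list a) = (\<Union>x\<in>corner_rows a \<times> UNIV. last_SYT a x)"
proof (intro equalityI subsetI)
  fix TN assume TN: "TN \<in> signed_SYT (row_list a)"
  obtain T N where [simp]: "TN = (T, N)" by (cases TN)
  have T: "is_SYT (row_list a) T" using TN by (simp add: signed_SYT_def)
  then have "size a \<in> T ` cells (row_list a)" using n by (simp add: is_SYT_def sum_row_list bij_betw_def)
  then obtain r c where rc: "(r, c) \<in> cells (row_list a)" "T (r, c) = size a" by auto
  then obtain i where r: "r = Suc i" and c: "1 \<le> c" "c \<le> a i" using cells_row_list[OF a] by (cases r) auto
  \<comment> \<open>A cell to the right of the largest entry, or below it, would have to hold a
    still larger entry; hence this entry sits in a corner.\<close>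
  have "(Suc i, Suc c) \<notin> cells (row_list a)"
    using T rc is_SYT_le[OF T, of "(Suc i, Suc c)"] unfolding is_SYT_def r by (metis not_less)
  then have ci: "c = a i" using c by (simp add: cells_row_list[OF a])
  have "(Suc (Suc i), c) \<notin> cells (row_list a)"
    using T rc is_SYT_le[OF T, of "(Suc (Suc i), c)"] unfolding is_SYT_def r by (metis not_less)
  then have "i \<in> corner_rows a" using c ci by (simp add: cells_row_list[OF a] corner_rows_def)
  moreover have "TN \<in> last_SYT a (i, (Suc i, a i) \<in> N)"
    using TN rc by (simp add: last_SYT_def r ci)
  ultimately show "TN \<in> (\<Union>x\<in>corner_rows a \<times> UNIV. last_SYT a x)" by blast
qed (auto simp: last_SYT_def)

lemma last_SYT_disjoint:
  assumes a: "shape a" and "i \<in> corner_rows a" "j \<in> corner_rows a" "(i, s) \<noteq> (j, s')"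
  shows "last_SYT a (i, s) \<inter> last_SYT a (j, s') = {}"
proof (rule ccontr)
  assume "last_SYT a (i, s) \<inter> last_SYT a (j, s') \<noteq> {}"
  then obtain T N where TN: "(T, N) \<in> last_SYT a (i, s)" "(T, N) \<in> last_SYT a (j, s')" by auto
  then have "inj_on T (cells (row_list a))" "T (Suc i, a i) = T (Suc j, a j)"
    by (auto simp: last_SYT_def signed_SYT_def is_SYT_def bij_betw_def)
  then have "i = j" using corner_in_cells[OF a assms(2)] corner_in_cells[OF a assms(3)]
    by (auto dest!: inj_onD)
  then show False using TN assms(4) by (auto simp: last_SYT_def)
qed

lemma finite_signed_SYT: "finite (signed_SYT lam)"
proof -
  note fin = finite_cells[of lam]
  have "finite {T. \<forall>x. (x \<in> cells lam \<longrightarrow> T x \<in> {1..sum_list lam}) \<and> (x \<notin> cells lam \<longrightarrow> T x = 0)}"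
    using fin by (rule finite_set_of_finite_funs) simp
  moreover have "{T. is_SYT lam T} \<subseteq> {T. \<forall>x. (x \<in> cells lam \<longrightarrow> T x \<in> {1..sum_list lam}) \<and> (x \<notin> cells lam \<longrightarrow> T x = 0)}"
    unfolding is_SYT_def by (blast dest: bij_betwE)
  ultimately have "finite {T. is_SYT lam T}" by (rule rev_finite_subset)
  moreover have "signed_SYT lam \<subseteq> {T. is_SYT lam T} \<times> Pow (cells lam)" by (auto simp: signed_SYT_def)
  ultimately show ?thesis using fin by (meson finite_Pow_iff finite_SigmaI finite_subset)
qed

lemma sum_signed_SYT_last:
  assumes a: "shape a" and n: "size a > 0"
  shows "(\<Sum>TN\<in>signed_SYT (row_list a). F TN) = (\<Sum>x\<in>corner_rows a \<times> UNIV. \<Sum>TN\<in>last_SYT a x. F TN)"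
  unfolding signed_SYT_last[OF assms]
proof (rule sum.UNION_disjoint)
  show "\<forall>x\<in>corner_rows a \<times> UNIV. finite (last_SYT a x)"
    using finite_signed_SYT by (auto simp: last_SYT_def)
  show "\<forall>x\<in>corner_rows a \<times> UNIV. \<forall>y\<in>corner_rows a \<times> UNIV. x \<noteq> y \<longrightarrow> last_SYT a x \<inter> last_SYT a y = {}"
  proof (intro ballI impI)
    fix x y :: "nat \<times> bool"
    assume "x \<in> corner_rows a \<times> UNIV" "y \<in> corner_rows a \<times> UNIV" "x \<noteq> y"
    then show "last_SYT a x \<inter> last_SYT a y = {}"
      using last_SYT_disjoint[OF a, of "fst x" "fst y" "snd x" "snd y"] by auto
  qed
qed (use finite_corner_rows[OF a] in auto)

lemma neg_add_last:
  assumes a: "shape a" "i \<in> corner_rows a" and TN: "TN \<in> signed_SYT (row_list (dec_row a i))"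
  shows "Neg (add_last a (i, s) TN) = Neg TN \<union> (if s then {size a} else {})"
    and "neg (add_last a (i, s) TN) = neg TN + (if s then 1 else 0)"
    and "Neg TN \<subseteq> {1..size (dec_row a i)}"
proof -
  have x: "(Suc i, a i) \<notin> snd TN" using TN by (auto simp: signed_SYT_def cells_dec_row[OF a])
  then show N: "Neg (add_last a (i, s) TN) = Neg TN \<union> (if s then {size a} else {})"
    unfolding Neg_def add_last_def fst_conv snd_conv by (auto simp: image_iff)
  show sub: "Neg TN \<subseteq> {1..size (dec_row a i)}"
    using TN is_SYT_le by (auto simp: Neg_def signed_SYT_def)
  then have "finite (Neg TN)" using finite_subset by blast
  moreover have "size a \<notin> Neg TN" using sub size_dec_row[OF a] by auto
  ultimately show "neg (add_last a (i, s) TN) = neg TN + (if s then 1 else 0)"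
    by (simp add: neg_def N)
qed

text \<open>Below the old maximum the descent condition only involves entries whose rows and signs
  are unchanged. The single new candidate is the old maximum itself, which could not be a descent
  before since descents stop one short of the size.\<close>

lemma maj_add_last:
  assumes a: "shape a" "i \<in> corner_rows a" and TN: "TN \<in> last_SYT (dec_row a i) y" and y: "fst y \<in> corner_rows (dec_row a i)"
  shows "maj (row_list a) (add_last a (i, s) TN) = maj (row_list (dec_row a i)) TN +
    (if desc y (i, s) then size (dec_row a i) else 0)"
proof -
  let ?x = "(Suc i, a i)" and ?c = "dec_row a i" and ?TN = "add_last a (i, s) TN"
  define n where "n = size ?c"
  obtain T N where TN': "TN = (T, N)" by (cases TN)
  have S: "TN \<in> signed_SYT (row_list ?c)" using TN by (simp add: last_SYT_def)
  have T: "is_SYT (row_list ?c) T" using S by (simp add: signed_SYT_def TN')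
  have c: "shape ?c" by (rule shape_dec_row[OF a])
  define T' where "T' = T(?x := Suc n)"
  have sz: "size a = Suc n" using size_dec_row[OF a] by (simp add: n_def)
  have fT': "fst ?TN = T'" by (simp add: add_last_def T'_def sz TN')
  have T': "is_SYT (row_list a) T'" using is_SYT_insert[OF a T] by (simp add: T'_def sz)
  have injs: "inj_on T (cells (row_list ?c))" "inj_on T' (cells (row_list a))"
    using T T' by (auto simp: is_SYT_def bij_betw_def)
  have row_x: "row_of (row_list a) T' (Suc n) = Suc i"
    using row_of_eq[OF injs(2) corner_in_cells[OF a]] by (simp add: T'_def)
  have row: "row_of (row_list a) T' (T z) = fst z \<and> row_of (row_list ?c) T (T z) = fst z"
    if "z \<in> cells (row_list ?c)" for z
  proof -
    have "z \<in> cells (row_list a)" "z \<noteq> ?x" using that by (auto simp: cells_dec_row[OF a])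
    then show ?thesis using row_of_eq[OF injs(2), of z] row_of_eq[OF injs(1) that] by (auto simp: T'_def)
  qed
  have row_same: "row_of (row_list a) T' k = row_of (row_list ?c) T k" if "1 \<le> k" "k \<le> n" for k
  proof -
    have "k \<in> T ` cells (row_list ?c)" using T that by (simp add: is_SYT_def sum_row_list bij_betw_def n_def)
    then show ?thesis using row by auto
  qed
  have z: "(Suc (fst y), ?c (fst y)) \<in> cells (row_list ?c)" by (rule corner_in_cells[OF c y])
  have Tz: "T (Suc (fst y), ?c (fst y)) = n" using TN by (simp add: last_SYT_def TN' n_def)
  have row_n: "row_of (row_list a) T' n = Suc (fst y)" using row[OF z] Tz by simp
  have n1: "n \<ge> 1" using is_SYT_le[OF T z] Tz by simp
  have neg_n: "n \<in> Neg TN \<longleftrightarrow> snd y"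
  proof -
    have "n \<in> Neg TN \<longleftrightarrow> (Suc (fst y), ?c (fst y)) \<in> N"
      unfolding Neg_def TN' fst_conv snd_conv
      using inj_on_image_mem_iff[OF injs(1) z, of N] S Tz by (simp add: signed_SYT_def TN')
    then show ?thesis using TN by (simp add: last_SYT_def TN')
  qed
  note Neg = neg_add_last(1)[OF a S, of s] neg_add_last(3)[OF a S]
  have NegN: "k \<in> Neg ?TN \<longleftrightarrow> k \<in> Neg TN" if "k \<le> n" for k using Neg(1) that sz by auto
  have NegS: "Suc n \<in> Neg ?TN \<longleftrightarrow> s" using Neg sz by (auto simp: n_def)
  have Des: "Des (row_list a) ?TN = Des (row_list ?c) TN \<union> (if desc y (i, s) then {n} else {})"
  proof -
    have "k \<in> Des (row_list a) ?TN \<longleftrightarrow> k \<in> Des (row_list ?c) TN \<union> (if desc y (i, s) then {n} else {})" for k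
    proof -
      consider "k = 0" | "1 \<le> k" "k < n" | "k = n" "k > 0" | "k > n" by linarith
      then show ?thesis
      proof cases
        case 1
        then show ?thesis using n1 by (simp add: Des_def)
      next
        case 2
        then show ?thesis
          unfolding Des_def fT' sum_row_list sz
          by (auto simp: row_same NegN[unfolded TN'] TN' n_def[symmetric])
      next
        case 3
        then show ?thesis
          unfolding Des_def fT' sum_row_list sz
          using n1 by (auto simp add: row_n row_x NegS NegN neg_n desc_def n_def[symmetric])
      next
        case 4
        then show ?thesis using n1 by (auto simp: Des_def sum_row_list sz n_def[symmetric])
      qed
    qed
    then show ?thesis by blast
  qed
  have fin: "finite (Des (row_list ?c) TN)" "n \<notin> Des (row_list ?c) TN"
    using n1 by (auto simp: Des_def sum_row_list n_def[symmetric])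
  then show ?thesis unfolding maj_def Des n_def[symmetric] by simp
qed

lemma signed_SYT_empty:
  assumes "shape a" "size a = 0"
  shows "signed_SYT (row_list a) = {(\<lambda>_. 0, {})}" "corner_rows a = {}"
    and "maj (row_list a) TN = 0"
proof -
  have a0: "a = (\<lambda>_. 0)"
  proof
    fix i show "a i = 0" using assms by (cases "i < L") (auto simp: size_def shape_def)
  qed
  then have "cells (row_list a) = {}" by (auto simp: cells_def)
  then show "signed_SYT (row_list a) = {(\<lambda>_. 0, {})}"
    by (auto simp: signed_SYT_def is_SYT_def sum_row_list assms(2) bij_betw_def)
  show "corner_rows a = {}" by (simp add: a0 corner_rows_def)
  show "maj (row_list a) TN = 0" by (simp add: maj_def Des_def sum_row_list assms(2))
qed

text \<open>Induction on the size: after removal of the largest entry, the row and sign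
  \<open>y\<close> of the next one decide whether \<open>n\<close> is a descent. From a single cell
  only the empty tableau remains, which explains the extra summand 1 of the recursion at
  \<open>n = 0\<close>.\<close>

lemma sum_last_SYT_eq_last_gf:
  fixes q t :: "'a::comm_semiring_1"
  assumes "shape a" "i \<in> corner_rows a" "size a = n"
  shows "(\<Sum>TN\<in>last_SYT a (i, s). q ^ maj (row_list a) TN * t ^ neg TN) = last_gf q t n a (i, s)"
  using assms
proof (induction n arbitrary: a i s)
  case 0
  then show ?case using size_dec_row[of a i] by simp
next
  case (Suc n)
  let ?c = "dec_row a i"
  note a = Suc.prems(1,2)
  have c: "shape ?c" "size ?c = n" using shape_dec_row[OF a] size_dec_row[OF a] Suc.prems(3) by auto
  let ?w = "\<lambda>TN. q ^ maj (row_list a) (add_last a (i, s) TN) * t ^ neg (add_last a (i, s) TN)"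
  have "(\<Sum>TN\<in>last_SYT a (i, s). q ^ maj (row_list a) TN * t ^ neg TN) = (\<Sum>TN\<in>signed_SYT (row_list ?c). ?w TN)"
    by (rule sum_last_SYT[OF a])
  also have "\<dots> = (if s then t else 1) * ((if n = 0 then 1 else 0) +
     (\<Sum>y\<in>corner_rows ?c \<times> UNIV. (if desc y (i, s) then q ^ n else 1) * last_gf q t n ?c y))"
  proof (cases "n = 0")
    case True
    have "maj (row_list a) TN = 0" for TN
      using True Suc.prems(3) by (simp add: maj_def Des_def sum_row_list)
    moreover have "neg (\<lambda>_. 0, {}) = 0" by (simp add: neg_def Neg_def)
    moreover have "(\<lambda>_. 0, {}) \<in> signed_SYT (row_list ?c)" using signed_SYT_empty(1)[OF c(1)] True c(2) by simp
    ultimately show ?thesis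
      using True c signed_SYT_empty[OF c(1)] neg_add_last(2)[OF a] by simp
  next
    case False
    have "(\<Sum>TN\<in>signed_SYT (row_list ?c). ?w TN) = (\<Sum>y\<in>corner_rows ?c \<times> UNIV. \<Sum>TN\<in>last_SYT ?c y. ?w TN)"
      using False c by (intro sum_signed_SYT_last) auto
    also have "\<dots> = (\<Sum>y\<in>corner_rows ?c \<times> UNIV. (if s then t else 1) * ((if desc y (i, s) then q ^ n else 1) * last_gf q t n ?c y))"
    proof (rule sum.cong[OF refl])
      fix y :: "nat \<times> bool" assume y: "y \<in> corner_rows ?c \<times> UNIV"
      have "?w TN = (if s then t else 1) * (if desc y (i, s) then q ^ n else 1) * (q ^ maj (row_list ?c) TN * t ^ neg TN)"
        if TN: "TN \<in> last_SYT ?c y" for TN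
        using maj_add_last[OF a TN, of s] neg_add_last(2)[OF a, of TN s] TN y c(2)
        by (auto simp: last_SYT_def power_add mult_ac)
      then have "(\<Sum>TN\<in>last_SYT ?c y. ?w TN)
        = (if s then t else 1) * (if desc y (i, s) then q ^ n else 1) * (\<Sum>TN\<in>last_SYT ?c y. q ^ maj (row_list ?c) TN * t ^ neg TN)"
        unfolding sum_distrib_left by (intro sum.cong refl)
      also have "(\<Sum>TN\<in>last_SYT ?c y. q ^ maj (row_list ?c) TN * t ^ neg TN) = last_gf q t n ?c y"
        using Suc.IH[OF c(1) _ c(2), of "fst y" "snd y"] y by auto
      finally show "(\<Sum>TN\<in>last_SYT ?c y. ?w TN) = (if s then t else 1) * ((if desc y (i, s) then q ^ n else 1) * last_gf q t n ?c y)"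
        by (simp only: mult.assoc)
    qed
    finally show ?thesis using False by (simp add: sum_distrib_left)
  qed
  finally show ?case by simp
qed

lemma sum_signed_SYT_eq_total_gf:
  fixes q t :: "'a::comm_semiring_1"
  assumes "shape a"
  shows "(\<Sum>TN\<in>signed_SYT (row_list a). q ^ maj (row_list a) TN * t ^ neg TN) = total_gf q t (size a) a"
proof (cases "size a = 0")
  case True
  then show ?thesis using assms by (simp add: signed_SYT_empty total_gf_def neg_def Neg_def)
next
  case False
  then show ?thesis
    unfolding total_gf_def using assms
    by (subst sum_signed_SYT_last) (auto intro!: sum.cong simp: sum_last_SYT_eq_last_gf)
qed

section \<open>Hook lengths and beta numbers\<close>

text \<open>The conjugate partition; for a shape the least row exists because
  \<open>a L = 0\<close>.\<close>

definition col_len :: "(nat \<Rightarrow> nat) \<Rightarrow> nat \<Rightarrow> nat" where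
  "col_len a c = (LEAST r. a r \<le> c)"

lemma col_len:
  assumes "shape a"
  shows "r < col_len a c \<longleftrightarrow> c < a r" and "col_len a c \<le> L"
proof -
  have L: "a L \<le> c" using assms by (simp add: shape_def)
  then show "col_len a c \<le> L" unfolding col_len_def by (rule Least_le)
  have "a (col_len a c) \<le> c" unfolding col_len_def using L by (rule LeastI)
  then show "r < col_len a c \<longleftrightarrow> c < a r"
    using not_less_Least[of r "\<lambda>r. a r \<le> c"] shape_antimono[OF assms, of "col_len a c" r]
    unfolding col_len_def[symmetric] by linarith
qed

lemma hook_row_list:
  assumes "shape a"
  shows "hook (row_list a) (Suc i, Suc c) = (a i - c) + (col_len a c - Suc i)"
proof -
  have "{c'. (Suc i, c') \<in> cells (row_list a) \<and> Suc c \<le> c'} = {Suc c..a i}"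
    using cells_row_list[OF assms] by auto
  moreover have "{r'. (r', Suc c) \<in> cells (row_list a) \<and> Suc i < r'} = {Suc (Suc i)..col_len a c}"
  proof -
    have "(r', Suc c) \<in> cells (row_list a) \<and> Suc i < r' \<longleftrightarrow> r' \<in> {Suc (Suc i)..col_len a c}" for r'
      using col_len(1)[OF assms, of "r' - 1" c] by (cases r') (auto simp: cells_row_list[OF assms])
    then show ?thesis by blast
  qed
  ultimately show ?thesis by (simp add: hook_def)
qed

lemma prod_hooks_row:
  fixes F :: "nat \<Rightarrow> 'a::comm_monoid_mult"
  assumes a: "shape a" and i: "i < L"
  shows "(\<Prod>c<a i. F (hook (row_list a) (Suc i, Suc c))) * (\<Prod>j\<in>{i<..<L}. F (beta a i - beta a j))
    = (\<Prod>k\<in>{1..beta a i}. F k)"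
proof - \<comment> \<open>the hook lengths of row \<open>i\<close> and the differences \<open>\<beta>\<^sub>i - \<beta>\<^sub>j\<close> partition \<open>{1..\<beta>\<^sub>i}\<close>\<close>
  define h where "h c = (a i - c) + (col_len a c - Suc i)" for c
  define d where "d j = beta a i - beta a j" for j
  have d_eq: "d j = (a i - a j) + (j - i)" if "i < j" "j < L" for j
    using that shape_antimono[OF a, of i j] by (simp add: d_def beta_def)
  have col: "i < col_len a c" if "c < a i" for c using col_len(1)[OF a] that by simp
  have col_mono: "col_len a c' \<le> col_len a c" if "c \<le> c'" for c c'
    using col_len(1)[OF a, of "col_len a c" c] col_len(1)[OF a, of "col_len a c" c'] that by linarith
  have "h c' < h c" if "c < c'" "c' < a i" for c c'
    using that col_mono[of c c'] by (simp add: h_def)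
  then have inj_h: "inj_on h {..<a i}"
    by (intro inj_onI) (metis lessThan_iff less_irrefl linorder_neqE_nat)
  have "d j < d j'" if "i < j" "j < j'" "j' < L" for j j'
    using beta_less[OF a that(2,3)] beta_less[OF a, of i j'] that by (simp add: d_def)
  then have inj_d: "inj_on d {i<..<L}"
    by (intro inj_onI) (metis greaterThanLessThan_iff less_irrefl linorder_neqE_nat)
  \<comment> \<open>If the cell in row \<open>j\<close> and column \<open>c\<close> belongs to the
    shape, the hook length \<open>h c\<close> exceeds \<open>d j\<close>; otherwise it is
    smaller.\<close>
  have disj: "h c \<noteq> d j" if "c < a i" "i < j" "j < L" for c j
  proof (cases "j < col_len a c")
    case True
    then have "c < a j" using col_len(1)[OF a] by simp
    then show ?thesis using True that shape_antimono[OF a, of i j] by (simp add: h_def d_eq)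
  next
    case False
    then have "a j \<le> c" using col_len(1)[OF a, of j c] by simp
    then show ?thesis using False that col[OF that(1)] shape_antimono[OF a, of i j] by (simp add: h_def d_eq)
  qed
  have disjoint: "h ` {..<a i} \<inter> d ` {i<..<L} = {}" using disj by fastforce
  have "h ` {..<a i} \<union> d ` {i<..<L} \<subseteq> {1..beta a i}"
  proof -
    have "1 \<le> h c \<and> h c \<le> beta a i" if "c < a i" for c
      using that i col_len(2)[OF a, of c] by (auto simp: h_def beta_def)
    moreover have "1 \<le> d j \<and> d j \<le> beta a i" if "i < j" "j < L" for j
      using beta_less[OF a that] by (simp add: d_def)
    ultimately show ?thesis by fastforce
  qed
  \<comment> \<open>There are \<open>a i\<close> hook lengths and \<open>L - 1 - i\<close>
    differences, together \<open>beta a i\<close> numbers, so they fill the whole interval.\<close>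
  moreover have "card (h ` {..<a i} \<union> d ` {i<..<L}) = card {1..beta a i}"
    using i by (subst card_Un_disjoint) (auto simp: disjoint card_image inj_h inj_d beta_def)
  ultimately have un: "h ` {..<a i} \<union> d ` {i<..<L} = {1..beta a i}"
    by (intro card_subset_eq) auto
  have "(\<Prod>k\<in>{1..beta a i}. F k) = (\<Prod>k\<in>h ` {..<a i}. F k) * (\<Prod>k\<in>d ` {i<..<L}. F k)"
    unfolding un[symmetric] by (rule prod.union_disjoint) (use disjoint in auto)
  then show ?thesis
    by (simp add: prod.reindex inj_h inj_d hook_row_list[OF a] h_def[symmetric] d_def[symmetric])
qed

lemma prod_cells_row_list:
  fixes F :: "nat \<times> nat \<Rightarrow> 'a::comm_monoid_mult"
  assumes a: "shape a"
  shows "(\<Prod>x\<in>cells (row_list a). F x) = (\<Prod>i<L. \<Prod>c<a i. F (Suc i, Suc c))"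
proof -
  have "(\<Prod>i<L. \<Prod>c<a i. F (Suc i, Suc c)) = (\<Prod>(i,c)\<in>(SIGMA i:{..<L}. {..<a i}). F (Suc i, Suc c))"
    by (rule prod.Sigma) auto
  also have "\<dots> = (\<Prod>x\<in>cells (row_list a). F x)"
    by (rule prod.reindex_bij_witness[where i = "\<lambda>(r,c). (r - 1, c - 1)" and j = "\<lambda>(i,c). (Suc i, Suc c)"])
      (auto simp: cells_def)
  finally show ?thesis by simp
qed

end

section \<open>Determinants\<close>

text \<open>Distributivity, with families of choices extended by 0 from \<open>L\<close> on as for
  shapes, instead of extensional functions.\<close>

lemma sum_prod_box:
  fixes f :: "nat \<Rightarrow> 'b::zero \<Rightarrow> 'a::comm_semiring_1"
  assumes "\<And>i. i < L \<Longrightarrow> finite (I i)"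
  shows "(\<Sum>v | (\<forall>i<L. v i \<in> I i) \<and> (\<forall>i\<ge>L. v i = 0). \<Prod>i<L. f i (v i)) = (\<Prod>i<L. \<Sum>k\<in>I i. f i k)"
proof -
  have "(\<Prod>i<L. \<Sum>k\<in>I i. f i k) = (\<Sum>v\<in>PiE {..<L} I. \<Prod>i<L. f i (v i))"
    using assms by (intro prod_sum_PiE) auto
  also have "\<dots> = (\<Sum>v | (\<forall>i<L. v i \<in> I i) \<and> (\<forall>i\<ge>L. v i = 0). \<Prod>i<L. f i (v i))"
    by (rule sum.reindex_bij_witness[where j = "\<lambda>v i. if i < L then v i else 0"
          and i = "\<lambda>v. restrict v {..<L}"])
      (auto simp: PiE_def Pi_def extensional_def fun_eq_iff)
  finally show ?thesis by simp
qed

text \<open>Multilinearity of the determinant in its rows, read off the Leibniz formula: if the rows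
  vary independently, a sum of determinants is one determinant.\<close>

lemma sum_det_box:
  fixes f :: "nat \<Rightarrow> nat \<Rightarrow> 'b::zero \<Rightarrow> 'a::comm_ring_1"
  assumes "\<And>i. i < L \<Longrightarrow> finite (I i)"
  shows "(\<Sum>v | (\<forall>i<L. v i \<in> I i) \<and> (\<forall>i\<ge>L. v i = 0). det (mat L L (\<lambda>(i,s). f i s (v i))))
    = det (mat L L (\<lambda>(i,s). \<Sum>k\<in>I i. f i s k))"
proof -
  have perm: "p i < L" if "p permutes {0..<L}" "i < L" for p i
    using permutes_in_image[OF that(1), of i] that(2) by simp
  have "det (mat L L (\<lambda>(i,s). \<Sum>k\<in>I i. f i s k))
     = (\<Sum>p | p permutes {0..<L}. signof p * (\<Prod>i<L. \<Sum>k\<in>I i. f i (p i) k))"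
    by (auto simp: det_def atLeast0LessThan[symmetric] perm intro!: sum.cong prod.cong)
  also have "\<dots> = (\<Sum>p | p permutes {0..<L}. \<Sum>v | (\<forall>i<L. v i \<in> I i) \<and> (\<forall>i\<ge>L. v i = 0).
       signof p * (\<Prod>i<L. f i (p i) (v i)))"
    by (simp add: sum_prod_box[OF assms, symmetric] sum_distrib_left)
  also have "\<dots> = (\<Sum>v | (\<forall>i<L. v i \<in> I i) \<and> (\<forall>i\<ge>L. v i = 0). \<Sum>p | p permutes {0..<L}.
       signof p * (\<Prod>i<L. f i (p i) (v i)))"
    by (rule sum.swap)
  also have "\<dots> = (\<Sum>v | (\<forall>i<L. v i \<in> I i) \<and> (\<forall>i\<ge>L. v i = 0). det (mat L L (\<lambda>(i,s). f i s (v i))))"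
    by (auto simp: det_def atLeast0LessThan[symmetric] perm intro!: sum.cong prod.cong)
  finally show ?thesis by simp
qed

text \<open>The matrix factors as diagonal times Vandermonde times triangular. The triangular factor
  encodes column operations and contributes only its diagonal.\<close>

lemma det_scale_triangular:
  fixes x g :: "nat \<Rightarrow> 'a::idom" and c :: "nat \<Rightarrow> nat \<Rightarrow> 'a"
  assumes "(\<forall>r s. s < r \<longrightarrow> c r s = 0) \<or> (\<forall>r s. r < s \<longrightarrow> c r s = 0)"
  shows "det (mat L L (\<lambda>(i,s). g i * (\<Sum>r<L. x i ^ r * c r s)))
    = (\<Prod>i<L. g i) * det (mat L L (\<lambda>(i,s). x i ^ s)) * (\<Prod>s<L. c s s)"
proof -
  let ?G = "mat L L (\<lambda>(i,s). if i = s then g i else 0)"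
  let ?X = "mat L L (\<lambda>(i,s). x i ^ s)"
  let ?C = "mat L L (\<lambda>(r,s). c r s)"
  have dl: "prod_list (diag_mat (mat L L (\<lambda>(r,s). h r s))) = (\<Prod>s<L. h s s)" for h :: "nat \<Rightarrow> nat \<Rightarrow> 'a"
    by (auto simp: diag_mat_def atLeast0LessThan prod.distinct_set_conv_list[symmetric] intro!: prod.cong)
  have G: "det ?G = (\<Prod>i<L. g i)"
    by (subst det_upper_triangular[of _ L]) (auto simp: dl)
  have C: "det ?C = (\<Prod>s<L. c s s)"
    using assms
  proof
    assume "\<forall>r s. s < r \<longrightarrow> c r s = 0"
    then show ?thesis by (subst det_upper_triangular[of _ L]) (auto simp: dl)
  next
    assume "\<forall>r s. r < s \<longrightarrow> c r s = 0"
    then show ?thesis by (subst det_lower_triangular[of L]) (auto simp: dl)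
  qed
  have "mat L L (\<lambda>(i,s). g i * (\<Sum>r<L. x i ^ r * c r s)) = ?G * (?X * ?C)"
    by (rule eq_matI)
      (auto simp: scalar_prod_def atLeast0LessThan if_distrib[of "\<lambda>x. x * _"] cong: if_cong)
  moreover have "det (?G * (?X * ?C)) = det ?G * det (?X * ?C)"
    by (rule det_mult[of _ L]) auto
  moreover have "det (?X * ?C) = det ?X * det ?C"
    by (rule det_mult[of _ L]) auto
  ultimately show ?thesis by (simp add: G C mult.assoc)
qed

lemma det_vandermonde:
  fixes x :: "nat \<Rightarrow> 'a::idom"
  shows "det (mat L L (\<lambda>(i,s). x i ^ s)) = (\<Prod>j<L. \<Prod>k<j. x j - x k)"
proof - \<comment> \<open>pass to the basis of Newton polynomials, which makes the matrix triangular\<close>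
  define p where "p j = (\<Prod>k<j. [:- x k, 1:])" for j
  have monic: "degree (p j) = j \<and> coeff (p j) j = 1" for j
  proof (induction j)
    case (Suc j)
    have ps: "p (Suc j) = p j * [:- x j, 1:]" by (simp add: p_def)
    moreover from Suc have "p j \<noteq> 0" by auto
    ultimately have "degree (p (Suc j)) = Suc j"
      using Suc by (metis degree_mult_eq degree_pCons_eq_if One_nat_def Suc_eq_plus1 one_neq_zero pCons_eq_0_iff degree_1 one_pCons)
    then show ?case using Suc ps
      by (simp add: coeff_eq_0)
  qed (simp add: p_def)
  have ev: "poly (p s) (x i) = (\<Sum>r<L. x i ^ r * coeff (p s) r)" if "s < L" for s i
  proof -
    have "poly (p s) (x i) = (\<Sum>r\<le>s. coeff (p s) r * x i ^ r)"
      using monic[of s] by (simp add: poly_altdef)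
    also have "\<dots> = (\<Sum>r<L. coeff (p s) r * x i ^ r)"
      using that monic[of s] by (intro sum.mono_neutral_left) (auto simp: coeff_eq_0)
    finally show ?thesis by (simp add: mult.commute)
  qed
  have "det (mat L L (\<lambda>(i,s). x i ^ s))
      = det (mat L L (\<lambda>(i,s). 1 * (\<Sum>r<L. x i ^ r * coeff (p s) r)))"
    using monic by (subst det_scale_triangular) (auto intro: coeff_eq_0)
  also have "mat L L (\<lambda>(i,s). 1 * (\<Sum>r<L. x i ^ r * coeff (p s) r)) = mat L L (\<lambda>(i,s). poly (p s) (x i))"
    by (auto simp: ev)
  also have "det \<dots> = (\<Prod>j<L. poly (p j) (x j))"
    by (subst det_lower_triangular[of L])
       (auto simp: p_def poly_prod diag_mat_def atLeast0LessThan prod.distinct_set_conv_list[symmetric] intro!: prod.cong)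
  finally show ?thesis by (simp add: p_def poly_prod)
qed

text \<open>Subtracting from each row the next one is multiplication by a unitriangular matrix. This
  undoes the differences left by telescoping sums over the parts of a horizontal strip.\<close>

lemma det_telescope_rows:
  fixes f :: "nat \<Rightarrow> nat \<Rightarrow> 'a::idom"
  shows "det (mat L L (\<lambda>(i,s). f i s - (if Suc i < L then f (Suc i) s else 0))) = det (mat L L (\<lambda>(i,s). f i s))"
proof -
  let ?U = "mat L L (\<lambda>(i,s). if i = s then 1 else if s = Suc i then -1 else (0::'a))"
  have "det ?U = 1"
    by (subst det_upper_triangular[of _ L])
       (auto simp: diag_mat_def atLeast0LessThan prod.distinct_set_conv_list[symmetric] intro!: prod.neutral)
  moreover have "mat L L (\<lambda>(i,s). f i s - (if Suc i < L then f (Suc i) s else 0)) = ?U * mat L L (\<lambda>(i,s). f i s)"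
  proof (rule eq_matI, goal_cases)
    case (1 i s)
    have "(\<Sum>r<L. (if i = r then 1 else if r = Suc i then -1 else 0) * f r s)
       = (\<Sum>r<L. (if i = r then f r s else 0) + (if Suc i = r then - f r s else 0))"
      by (rule sum.cong) auto
    also have "\<dots> = f i s - (if Suc i < L then f (Suc i) s else 0)"
      using 1 by (simp add: sum.distrib)
    finally show ?case using 1 by (simp add: scalar_prod_def atLeast0LessThan)
  qed auto
  ultimately show ?thesis by (simp add: det_mult[of _ L])
qed

lemma finite_box:
  assumes "\<And>i. i < L \<Longrightarrow> finite (I i)"
  shows "finite {v. (\<forall>i<(L::nat). v i \<in> I i) \<and> (\<forall>i\<ge>L. v i = (0::'b::zero))}" (is "finite ?B")
proof (rule finite_subset)
  show "?B \<subseteq> (\<lambda>v i. if i < L then v i else 0) ` PiE {..<L} I"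
  proof
    fix v assume v: "v \<in> ?B"
    then have "v = (\<lambda>i. if i < L then restrict v {..<L} i else 0)" by (auto simp: fun_eq_iff)
    moreover have "restrict v {..<L} \<in> PiE {..<L} I" using v by auto
    ultimately show "v \<in> (\<lambda>v i. if i < L then v i else 0) ` PiE {..<L} I" by blast
  qed
qed (use assms in \<open>auto intro!: finite_PiE\<close>)

section \<open>Strip identities for hook products\<close>

locale q_real = row_bound +
  fixes q :: real
  assumes q: "0 < q" "q < 1"
begin

definition vdm :: "(nat \<Rightarrow> nat) \<Rightarrow> real" where
  "vdm l = det (mat L L (\<lambda>(i,s). (q ^ l i) ^ s))"

text \<open>In Pochhammer notation this is \<open>(-u; q)_m / (q; q)_m\<close>. At
  \<open>u = t / q ^ (L - 1)\<close> and \<open>m = beta a i\<close> it is, up to a constant and a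
  power of \<open>q\<close>, the contribution of row \<open>i\<close> to
  \<open>H t a\<close>.\<close>

definition g :: "real \<Rightarrow> nat \<Rightarrow> real" where
  "g u m = (\<Prod>k<m. (1 + u * q ^ k) / (1 - q ^ Suc k))"

text \<open>The interlacing condition says that \<open>a / b\<close> is a horizontal strip. It
  bounds each row separately, so the strips form a box as in \<open>sum_det_box\<close>; for
  vertical strips the condition \<open>shape b\<close> couples the rows.\<close>

definition hstrips :: "(nat \<Rightarrow> nat) \<Rightarrow> (nat \<Rightarrow> nat) set" where
  "hstrips a = {b. (\<forall>i<L. b i \<in> {a (Suc i)..a i}) \<and> (\<forall>i\<ge>L. b i = 0)}"

definition vstrips :: "(nat \<Rightarrow> nat) \<Rightarrow> (nat \<Rightarrow> nat) set" where
  "vstrips a = {b. shape b \<and> (\<forall>i. b i \<le> a i \<and> a i \<le> Suc (b i))}"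

lemma q_pow_less_1: "q ^ Suc k < 1"
  using q by (intro power_Suc_less_one) auto

lemma q_pow_neq_1 [simp]: "q * q ^ k \<noteq> 1" "1 - q * q ^ k \<noteq> 0"
  using q_pow_less_1[of k] by auto

lemma g_0 [simp]: "g u 0 = 1"
  by (simp add: g_def)

lemma g_Suc: "g u (Suc m) = g u m * ((1 + u * q ^ m) / (1 - q ^ Suc m))"
  by (simp add: g_def)

text \<open>The product of \<open>1 + u * q ^ k\<close> over all \<open>k\<close> up to
  \<open>m\<close> has its last factor split off on the left and its first one on the right.\<close>

lemma g_shift: "g u m * (1 + u * q ^ m) = g (q * u) m * (1 + u)"
proof (induction m)
  case (Suc m)
  have "g u (Suc m) * (1 + u * q ^ Suc m) = (g u m * (1 + u * q ^ m)) * ((1 + u * q ^ Suc m) / (1 - q ^ Suc m))"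
    by (simp add: g_Suc)
  also have "\<dots> = g (q * u) (Suc m) * (1 + u)"
    unfolding Suc by (simp add: g_Suc mult_ac)
  finally show ?case .
qed simp

lemma g_Suc_pred:
  assumes "u > 0"
  shows "g u (Suc m) / (1 + u) = g (q * u) m / (1 - q ^ Suc m)"
    and "g (q * u) (Suc m) = g (q * u) m * (1 + u * q ^ Suc m) / (1 - q ^ Suc m)"
proof -
  show "g u (Suc m) / (1 + u) = g (q * u) m / (1 - q ^ Suc m)"
    using g_shift[of u m] assms by (simp add: g_Suc divide_simps)
  show "g (q * u) (Suc m) = g (q * u) m * (1 + u * q ^ Suc m) / (1 - q ^ Suc m)"
    by (simp add: g_Suc mult_ac)
qed

lemma add_divide_mult:
  fixes d :: real
  assumes "d \<noteq> 0"
  shows "a + b / d * c = (a * d + b * c) / d"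
  using assms by (simp add: field_simps)

text \<open>A row of a vertical strip loses no cell or one cell, the latter with weight
  \<open>t\<close>. Apart from a factor independent of \<open>s\<close>, the result combines just
  the powers \<open>s\<close> and \<open>Suc s\<close> of \<open>q ^ m\<close>: a column operation
  on the Vandermonde matrix.\<close>

lemma vertical_row_sum:
  assumes "u > 0"
  shows "(\<Sum>k\<in>{m-1..m}. t ^ (m - k) * (g (q * u) k * (q ^ k) ^ s))
    = g u m / (1 + u) * ((1 + t / q ^ s) * (q ^ m) ^ s + (u - t / q ^ s) * (q ^ m) ^ Suc s)"
proof (cases m)
  case 0
  then show ?thesis using assms by (simp add: field_simps)
next
  case (Suc k)
  define y where "y = q ^ k"
  define x where "x = q ^ Suc k"
  have x: "x = q * y" "1 - x \<noteq> 0" "x ^ s = q ^ s * y ^ s"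
    by (auto simp: x_def y_def power_mult_distrib)
  \<comment> \<open>The claim after removing the common factor and the denominator
    \<open>1 - x\<close>; here \<open>y\<close> is \<open>x / q\<close>.\<close>
  have "t * (y ^ s) * (1 - x) + (1 + u * x) * x ^ s = (1 + t / q ^ s) * x ^ s + (u - t / q ^ s) * x ^ Suc s"
    using q by (simp add: x(3) divide_simps) (simp add: algebra_simps)
  then have *: "t * y ^ s + (1 + u * x) / (1 - x) * x ^ s = ((1 + t / q ^ s) * x ^ s + (u - t / q ^ s) * x ^ Suc s) / (1 - x)"
    using add_divide_mult[OF x(2), of "t * y ^ s" "1 + u * x" "x ^ s"] by simp
  have g1: "g u m / (1 + u) = g (q * u) k / (1 - x)"
    using g_Suc_pred(1)[OF assms, of k] by (simp add: Suc x_def)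
  have "{m-1..m} = {k, Suc k}" using Suc by auto
  then have "(\<Sum>k\<in>{m-1..m}. t ^ (m - k) * (g (q * u) k * (q ^ k) ^ s))
    = g (q * u) k * (t * y ^ s + (1 + u * x) / (1 - x) * x ^ s)"
    using Suc g_Suc_pred(2)[OF assms, of k] unfolding x_def[symmetric] y_def[symmetric]
    by (simp add: x_def[symmetric] y_def[symmetric] distrib_left del: power_Suc)
  also have "\<dots> = g u m / (1 + u) * ((1 + t / q ^ s) * x ^ s + (u - t / q ^ s) * x ^ Suc s)"
    unfolding * g1 by simp
  finally show ?thesis unfolding Suc x_def .
qed

text \<open>The weight of one row of a horizontal strip, after a column operation, is a discrete
  difference in \<open>m\<close>, so its sum over the admissible lengths telescopes. At
  \<open>m = 0\<close> the missing predecessor counts as 0.\<close>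

lemma horizontal_row_diff:
  assumes "u > 0"
  shows "g (q * u) m * (q ^ m) ^ s - (if m = 0 then 0 else g (q * u) (m - 1) * (q ^ (m - 1)) ^ s)
    = g u m * q ^ m / (1 + u) * ((1 - 1 / q ^ s) * (q ^ m) ^ (s - 1) + (u + 1 / q ^ s) * (q ^ m) ^ s)"
proof (cases m)
  case 0
  then show ?thesis using assms by (simp add: field_simps)
next
  case (Suc k)
  define y where "y = q ^ k"
  define x where "x = q ^ Suc k"
  have x: "x = q * y" "1 - x \<noteq> 0" "x ^ s = q ^ s * y ^ s"
    by (auto simp: x_def y_def power_mult_distrib)
  \<comment> \<open>For \<open>s = 0\<close> the truncated exponent \<open>s - 1\<close> does no
    harm, since its coefficient \<open>1 - 1 / q ^ s\<close> vanishes.\<close>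
  have xs: "(1 - 1 / q ^ s) * (x * x ^ (s - 1)) = (1 - 1 / q ^ s) * x ^ s"
    by (cases s) auto
  have "(1 + u * x) * x ^ s - (1 - x) * y ^ s = (1 - 1 / q ^ s) * x ^ s + (u + 1 / q ^ s) * (x * x ^ s)"
    using q by (simp add: x(3) divide_simps) (simp add: algebra_simps)
  also have "\<dots> = x * ((1 - 1 / q ^ s) * x ^ (s - 1) + (u + 1 / q ^ s) * x ^ s)"
    unfolding xs[symmetric] by (simp add: algebra_simps)
  finally have *: "(1 + u * x) / (1 - x) * x ^ s - y ^ s = x * ((1 - 1 / q ^ s) * x ^ (s - 1) + (u + 1 / q ^ s) * x ^ s) / (1 - x)"
    using add_divide_mult[OF x(2), of "- (y ^ s)" "1 + u * x" "x ^ s"] by (simp add: mult.commute)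
  have g1: "g u m / (1 + u) = g (q * u) k / (1 - x)"
    using g_Suc_pred(1)[OF assms, of k] by (simp add: Suc x_def)
  have "g (q * u) m * (q ^ m) ^ s - (if m = 0 then 0 else g (q * u) (m - 1) * (q ^ (m - 1)) ^ s)
    = g (q * u) k * ((1 + u * x) / (1 - x) * x ^ s - y ^ s)"
    using Suc g_Suc_pred(2)[OF assms, of k]
    by (simp add: x_def[symmetric] y_def[symmetric] right_diff_distrib del: power_Suc)
  also have "\<dots> = g u m / (1 + u) * (x * ((1 - 1 / q ^ s) * x ^ (s - 1) + (u + 1 / q ^ s) * x ^ s))"
    unfolding * g1 by simp
  finally show ?thesis unfolding Suc x_def by simp
qed

text \<open>A strictly decreasing sequence of naturals stays above the staircase, so the staircase
  can be subtracted without truncation.\<close>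

lemma strict_ge:
  assumes "\<And>i. Suc i < L \<Longrightarrow> l (Suc i) < l i" "i < L"
  shows "L - 1 - i \<le> (l i :: nat)"
  using assms(2)
proof (induction "L - 1 - i" arbitrary: i)
  case (Suc d)
  then have "d = L - 1 - Suc i" "Suc i < L" by auto
  with Suc(1)[of "Suc i"] assms(1)[of i] Suc(2) show ?case by auto
qed simp

lemma vdm_eq_0:
  assumes "i < L" "j < L" "i \<noteq> j" "l i = l j"
  shows "vdm l = 0"
  unfolding vdm_def using assms
  by (intro det_identical_rows[of _ L i j]) (auto simp: row_def)

lemma vdm_scale:
  assumes "(\<forall>r s. s < r \<longrightarrow> c r s = 0) \<or> (\<forall>r s. r < s \<longrightarrow> c r s = 0)"
  shows "det (mat L L (\<lambda>(i,s). h i * (\<Sum>r<L. (q ^ l i) ^ r * c r s)))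
    = (\<Prod>i<L. h i) * vdm l * (\<Prod>s<L. c s s)"
  unfolding vdm_def by (rule det_scale_triangular[OF assms])

lemma vdm_row_scale:
  "det (mat L L (\<lambda>(i,s). h i * (q ^ l i) ^ s)) = (\<Prod>i<L. h i) * vdm l"
proof -
  have "det (mat L L (\<lambda>(i,s). h i * (\<Sum>r<L. (q ^ l i) ^ r * (if r = s then 1 else 0))))
    = (\<Prod>i<L. h i) * vdm l"
    by (subst vdm_scale) auto
  moreover have "mat L L (\<lambda>(i,s). h i * (\<Sum>r<L. (q ^ l i) ^ r * (if r = s then 1 else 0)))
    = mat L L (\<lambda>(i,s). h i * (q ^ l i) ^ s)"
    by (rule cong_mat) (auto simp: if_distrib cong: if_cong)
  ultimately show ?thesis by simp
qed

text \<open>Sum each row separately, then read the sums as a lower bidiagonal column operation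
  \<open>c\<close>. The sequences \<open>l\<close> need not be strictly decreasing here.\<close>

lemma vertical_box_sum:
  assumes "u > 0" and t: "t = u * q ^ (L - 1)"
  shows "(\<Sum>l | (\<forall>i<L. l i \<in> {m i - 1..m i}) \<and> (\<forall>i\<ge>L. l i = 0).
            (\<Prod>i<L. t ^ (m i - l i) * g (q * u) (l i)) * vdm l)
    = (\<Prod>s<L. (1 + t / q ^ s) / (1 + u)) * ((\<Prod>i<L. g u (m i)) * vdm m)"
proof -
  define c where "c r s = (if r = s then (1 + t / q ^ s) / (1 + u)
       else if r = Suc s then (u - t / q ^ s) / (1 + u) else 0)" for r s
  have "(\<Sum>l | (\<forall>i<L. l i \<in> {m i - 1..m i}) \<and> (\<forall>i\<ge>L. l i = 0).
            (\<Prod>i<L. t ^ (m i - l i) * g (q * u) (l i)) * vdm l)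
     = (\<Sum>l | (\<forall>i<L. l i \<in> {m i - 1..m i}) \<and> (\<forall>i\<ge>L. l i = 0).
         det (mat L L (\<lambda>(i,s). t ^ (m i - l i) * g (q * u) (l i) * (q ^ l i) ^ s)))"
    by (simp add: vdm_row_scale)
  also have "\<dots> = det (mat L L (\<lambda>(i,s). \<Sum>k\<in>{m i - 1..m i}. t ^ (m i - k) * g (q * u) k * (q ^ k) ^ s))"
    by (rule sum_det_box[where f = "\<lambda>i s k. t ^ (m i - k) * g (q * u) k * (q ^ k) ^ s"]) auto
  also have "mat L L (\<lambda>(i,s). \<Sum>k\<in>{m i - 1..m i}. t ^ (m i - k) * g (q * u) k * (q ^ k) ^ s)
    = mat L L (\<lambda>(i,s). g u (m i) * (\<Sum>r<L. (q ^ m i) ^ r * c r s))"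
  proof (rule cong_mat, goal_cases)
    case (3 i s)
    \<comment> \<open>This is where \<open>t = u * q ^ (L - 1)\<close> enters: in the last column
      the coefficient of the power \<open>L\<close>, which is no column of the matrix,
      vanishes.\<close>
    have "u - t / q ^ s = 0" if "Suc s = L"
      using that q t by auto
    then have "(\<Sum>r<L. (q ^ m i) ^ r * c r s)
       = (\<Sum>r\<in>{s, Suc s}. (q ^ m i) ^ r * c r s)"
      using 3 by (intro sum.mono_neutral_cong) (auto simp: c_def)
    also have "\<dots> = ((1 + t / q ^ s) * (q ^ m i) ^ s + (u - t / q ^ s) * (q ^ m i) ^ Suc s) / (1 + u)"
      by (simp add: c_def add_divide_distrib[symmetric] mult.commute)
    finally show ?case
      using vertical_row_sum[OF assms(1), where m = "m i" and t = t and s = s] by (simp add: mult_ac)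
  qed auto
  also have "det \<dots> = (\<Prod>i<L. g u (m i)) * vdm m * (\<Prod>s<L. c s s)"
    by (rule vdm_scale) (auto simp: c_def)
  finally show ?thesis by (simp add: c_def mult_ac)
qed

text \<open>Read backwards: an upper bidiagonal column operation turns the weights into the
  differences \<open>\<Delta>\<close>; their sums over the box telescope to \<open>\<Psi>\<close> at
  \<open>beta a i\<close> minus \<open>\<Psi>\<close> at \<open>beta a (Suc i)\<close>, and row
  operations remove the second term.\<close>

lemma horizontal_box_sum:
  assumes "u > 0" and a: "shape a"
  shows "(\<Prod>s<L. (u + 1 / q ^ s) / (1 + u)) *
      (\<Sum>b\<in>hstrips a. (\<Prod>i<L. g u (beta b i) * q ^ beta b i) * vdm (beta b))
    = (\<Prod>i<L. g (q * u) (beta a i)) * vdm (beta a)"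
proof -
  define c where "c r s = (if r = s then (u + 1 / q ^ s) / (1 + u)
       else if s = Suc r then (1 - 1 / q ^ s) / (1 + u) else 0)" for r s
  define \<Psi> where "\<Psi> m s = g (q * u) m * (q ^ m) ^ s" for m s
  define \<Delta> where "\<Delta> m s = \<Psi> m s - (if m = 0 then 0 else \<Psi> (m - 1) s)" for m s
  have D: "g u m * q ^ m * (\<Sum>r<L. (q ^ m) ^ r * c r s) = \<Delta> m s" if "s < L" for m s
  proof -
    have "(\<Sum>r<L. (q ^ m) ^ r * c r s) = (\<Sum>r\<in>{s - 1, s}. (q ^ m) ^ r * c r s)"
      using that by (intro sum.mono_neutral_right) (auto simp: c_def)
    also have "\<dots> = ((1 - 1 / q ^ s) * (q ^ m) ^ (s - 1) + (u + 1 / q ^ s) * (q ^ m) ^ s) / (1 + u)"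
      by (cases s) (simp_all add: c_def add_divide_distrib[symmetric] mult.commute)
    finally show ?thesis
      unfolding \<Delta>_def \<Psi>_def horizontal_row_diff[OF assms(1)] by simp
  qed
  \<comment> \<open>The summation starts one above \<open>beta a (Suc i)\<close>, so the subtracted
    boundary value is \<open>\<Psi>\<close> at exactly that number. In the last row it starts at 0
    and there is nothing to subtract.\<close>
  have tele: "(\<Sum>k\<in>{a (Suc i)..a i}. \<Delta> (k + (L - 1 - i)) s)
     = \<Psi> (beta a i) s - (if Suc i < L then \<Psi> (beta a (Suc i)) s else 0)" if "i < L" for i s
  proof -
    have le: "a (Suc i) \<le> a i" using a by (auto simp: shape_def)
    have "(\<Sum>k\<in>{p..<p+n}. \<Delta> (k + d) s) = (if p + n + d = 0 then 0 else \<Psi> (p + n + d - 1) s) - (if p + d = 0 then 0 else \<Psi> (p + d - 1) s)" for p n d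
      by (induction n) (auto simp: \<Delta>_def)
    from this[of "L - 1 - i" "a (Suc i)" "Suc (a i) - a (Suc i)"] le
    have "(\<Sum>k\<in>{a (Suc i)..a i}. \<Delta> (k + (L - 1 - i)) s)
      = \<Psi> (beta a i) s - (if a (Suc i) + (L - 1 - i) = 0 then 0 else \<Psi> (a (Suc i) + (L - 1 - i) - 1) s)"
      by (simp add: beta_def atLeastLessThanSuc_atLeastAtMost del: sum.op_ivl_Suc)
    moreover have "a (Suc i) = 0" if "\<not> Suc i < L" using a that by (auto simp: shape_def)
    moreover have "a (Suc i) + (L - 1 - i) - 1 = beta a (Suc i)" "a (Suc i) + (L - 1 - i) \<noteq> 0" if "Suc i < L"
      using that by (auto simp: beta_def)
    ultimately show ?thesis using that by auto
  qed
  have "(\<Prod>i<L. g (q * u) (beta a i)) * vdm (beta a)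
     = det (mat L L (\<lambda>(i,s). \<Psi> (beta a i) s))"
    by (simp add: \<Psi>_def vdm_row_scale)
  also have "\<dots> = det (mat L L (\<lambda>(i,s). \<Psi> (beta a i) s - (if Suc i < L then \<Psi> (beta a (Suc i)) s else 0)))"
    by (rule det_telescope_rows[symmetric])
  also have "\<dots> = det (mat L L (\<lambda>(i,s). \<Sum>k\<in>{a (Suc i)..a i}. \<Delta> (k + (L - 1 - i)) s))"
    by (rule arg_cong[where f = det], rule cong_mat, simp, simp, unfold prod.case, rule tele[symmetric])
  also have "\<dots> = (\<Sum>b\<in>hstrips a. det (mat L L (\<lambda>(i,s). \<Delta> (b i + (L - 1 - i)) s)))"
    unfolding hstrips_def by (rule sum_det_box[symmetric, where f = "\<lambda>i s k. \<Delta> (k + (L - 1 - i)) s"]) auto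
  also have "\<dots> = (\<Sum>b\<in>hstrips a. (\<Prod>i<L. g u (beta b i) * q ^ beta b i) * vdm (beta b) * (\<Prod>s<L. c s s))"
  proof (rule sum.cong[OF refl])
    fix b
    have "det (mat L L (\<lambda>(i,s). \<Delta> (b i + (L - 1 - i)) s))
       = det (mat L L (\<lambda>(i,s). (g u (beta b i) * q ^ beta b i) * (\<Sum>r<L. (q ^ beta b i) ^ r * c r s)))"
      by (rule arg_cong[where f = det], rule cong_mat) (auto simp: D beta_def)
    also have "\<dots> = (\<Prod>i<L. g u (beta b i) * q ^ beta b i) * vdm (beta b) * (\<Prod>s<L. c s s)"
      by (rule vdm_scale) (auto simp: c_def)
    finally show "det (mat L L (\<lambda>(i,s). \<Delta> (b i + (L - 1 - i)) s)) = \<dots>" .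
  qed
  finally show ?thesis by (simp add: c_def sum_distrib_left mult_ac)
qed

section \<open>Hook products in terms of beta numbers\<close>

definition qp :: "nat \<Rightarrow> real" where
  "qp n = (\<Prod>k<n. 1 - q ^ Suc k)"

text \<open>The product over all cells of
  \<open>(q ^ (r - 1) + t * q ^ (c - 1)) / (1 - q ^ h)\<close> with \<open>h\<close> the hook
  length, as \<open>H_eq_hooks\<close> shows; the hooks are expressed through beta numbers.\<close>

definition H :: "real \<Rightarrow> (nat \<Rightarrow> nat) \<Rightarrow> real" where
  "H t a = (\<Prod>i<L. (\<Prod>c<a i. q ^ i + t * q ^ c) / qp (beta a i)) *
           (\<Prod>j<L. \<Prod>i<j. 1 - q ^ (beta a i - beta a j))"

text \<open>The shape-independent correction in \<open>H_eq\<close>: row \<open>i\<close> has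
  \<open>a i\<close> cells but \<open>beta a i\<close> factors in \<open>g\<close>, and the
  \<open>L - 1 - i\<close> surplus factors are divided out.\<close>

definition H_const :: "real \<Rightarrow> real" where
  "H_const t = (\<Prod>i<L. 1 / (q ^ (i * (L - 1 - i)) * (\<Prod>k<L - 1 - i. 1 + t / q ^ (L - 1) * q ^ k)))"

lemma qp_nonzero [simp]: "qp n \<noteq> 0"
  by (simp add: qp_def)

lemma g_altdef: "g u m = (\<Prod>k<m. 1 + u * q ^ k) / qp m"
  by (simp add: g_def qp_def prod_dividef)

text \<open>Pulling \<open>q ^ i\<close> out of \<open>q ^ i + t * q ^ c\<close> leaves
  \<open>1 + t / q ^ (L - 1) * q ^ (c + d)\<close>, so the cells of the row continue the product
  over \<open>k < d\<close>.\<close>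

lemma row_product:
  assumes "i + d = L - 1"
  shows "(\<Prod>c<n. q ^ i + t * q ^ c) * (q ^ (i * d) * (\<Prod>k<d. 1 + t / q ^ (L - 1) * q ^ k))
    = q ^ (i * (n + d)) * (\<Prod>k<n + d. 1 + t / q ^ (L - 1) * q ^ k)"
proof (induction n)
  case (Suc n)
  have "q ^ (L - 1) = q ^ i * q ^ d" using assms by (metis power_add)
  then have *: "q ^ i + t * q ^ n = q ^ i * (1 + t / q ^ (L - 1) * q ^ (n + d))"
    using q by (simp add: power_add field_simps)
  have "(\<Prod>c<Suc n. q ^ i + t * q ^ c) * (q ^ (i * d) * (\<Prod>k<d. 1 + t / q ^ (L - 1) * q ^ k))
    = ((\<Prod>c<n. q ^ i + t * q ^ c) * (q ^ (i * d) * (\<Prod>k<d. 1 + t / q ^ (L - 1) * q ^ k)))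
      * (q ^ i + t * q ^ n)"
    by (simp only: prod.lessThan_Suc mult_ac)
  also have "\<dots> = q ^ (i * (Suc n + d)) * (\<Prod>k<Suc n + d. 1 + t / q ^ (L - 1) * q ^ k)"
    unfolding Suc * by (simp add: power_add mult_ac)
  finally show ?case .
qed simp

lemma vdm_beta:
  assumes "shape a"
  shows "vdm (beta a) = (\<Prod>j<L. q ^ (j * beta a j)) * (\<Prod>j<L. \<Prod>i<j. 1 - q ^ (beta a i - beta a j))"
proof -
  have "vdm (beta a) = (\<Prod>j<L. \<Prod>k<j. q ^ beta a j - q ^ beta a k)"
    unfolding vdm_def by (rule det_vandermonde)
  also have "\<dots> = (\<Prod>j<L. \<Prod>k<j. q ^ beta a j * (1 - q ^ (beta a k - beta a j)))"
  proof (intro prod.cong refl)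
    fix j k assume "j \<in> {..<L}" "k \<in> {..<j}"
    then have "beta a j < beta a k" using beta_less[OF assms] by auto
    then show "q ^ beta a j - q ^ beta a k = q ^ beta a j * (1 - q ^ (beta a k - beta a j))"
      by (simp add: right_diff_distrib power_add[symmetric])
  qed
  finally show ?thesis
    by (simp add: prod.distrib power_mult[symmetric] mult.commute)
qed

text \<open>The powers \<open>q ^ (i * beta a i)\<close> coming from the rows are the ones that
  \<open>vdm_beta\<close> extracts from the Vandermonde determinant.\<close>

lemma H_eq:
  assumes "shape a" "t > 0"
  shows "H t a = H_const t * ((\<Prod>i<L. g (t / q ^ (L - 1)) (beta a i)) * vdm (beta a))"
proof -
  define K where "K i = q ^ (i * (L - 1 - i)) * (\<Prod>k<L - 1 - i. 1 + t / q ^ (L - 1) * q ^ k)" for i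
  have "(\<Prod>k<d. 1 + t / q ^ (L - 1) * q ^ k) > 0" for d
    using q assms(2) by (intro prod_pos) (auto intro!: add_pos_nonneg)
  then have K: "K i > 0" for i using q by (simp add: K_def)
  have "(\<Prod>c<a i. q ^ i + t * q ^ c) / qp (beta a i)
     = 1 / K i * (g (t / q ^ (L - 1)) (beta a i) * q ^ (i * beta a i))" if "i < L" for i
  proof -
    have "(\<Prod>c<a i. q ^ i + t * q ^ c) * K i = q ^ (i * beta a i) * (\<Prod>k<beta a i. 1 + t / q ^ (L - 1) * q ^ k)"
      unfolding K_def beta_def using that by (intro row_product) auto
    then have "(\<Prod>c<a i. q ^ i + t * q ^ c) = q ^ (i * beta a i) * (\<Prod>k<beta a i. 1 + t / q ^ (L - 1) * q ^ k) / K i"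
      using K[of i] by (simp add: nonzero_eq_divide_eq)
    then show ?thesis by (simp add: g_altdef)
  qed
  then have "(\<Prod>i<L. (\<Prod>c<a i. q ^ i + t * q ^ c) / qp (beta a i))
    = (\<Prod>i<L. 1 / K i * (g (t / q ^ (L - 1)) (beta a i) * q ^ (i * beta a i)))"
    by (intro prod.cong) auto
  then show ?thesis
    unfolding H_def vdm_beta[OF assms(1)] H_const_def K_def[symmetric] prod.distrib by simp
qed

text \<open>Row by row this is the splitting used in \<open>g_shift\<close>, with last factor
  \<open>1 + t / q ^ i\<close>. The product over \<open>s\<close> is the constant of
  \<open>vertical_box_sum\<close>.\<close>

lemma H_const_shift:
  assumes "t > 0"
  shows "H_const (q * t) * (\<Prod>s<L. (1 + t / q ^ s) / (1 + t / q ^ (L - 1))) = H_const t"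
proof -
  define u where "u = t / q ^ (L - 1)"
  have u: "u > 0" using assms q by (simp add: u_def)
  have u': "q * t / q ^ (L - 1) = q * u" by (simp add: u_def)
  have pos: "(\<Prod>k<d. 1 + v * q ^ k) > 0" if "v > 0" for d v
    using q that by (intro prod_pos) (auto intro!: add_pos_nonneg)
  have shift: "(\<Prod>k<d. 1 + q * u * q ^ k) * (1 + u) = (\<Prod>k<d. 1 + u * q ^ k) * (1 + u * q ^ d)" for d
    by (induction d) (simp_all add: mult_ac)
  show ?thesis
    unfolding H_const_def prod.distrib[symmetric] u' u_def[symmetric]
  proof (intro prod.cong refl)
    fix i assume "i \<in> {..<L}"
    then have "u * q ^ (L - 1 - i) = t / q ^ i"
      using q by (auto simp: u_def field_simps power_add[symmetric])
    with shift[of "L - 1 - i"] have f1: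
      "(\<Prod>k<L - 1 - i. 1 + q * u * q ^ k) * (1 + u) = (\<Prod>k<L - 1 - i. 1 + u * q ^ k) * (1 + t / q ^ i)" by simp
    have aux: "1 / (x * A) * (D / B) = 1 / (x * C)" if "A * B = C * D" "A > 0" "C > 0" "B > 0" for x A B C D :: real
    proof -
      have D: "D = A * B / C" using that by (metis nonzero_mult_div_cancel_left order_less_irrefl)
      show ?thesis using that(2-4) unfolding D by simp
    qed
    show "1 / (q ^ (i * (L - 1 - i)) * (\<Prod>k<L - 1 - i. 1 + q * u * q ^ k)) * ((1 + t / q ^ i) / (1 + u))
       = 1 / (q ^ (i * (L - 1 - i)) * (\<Prod>k<L - 1 - i. 1 + u * q ^ k))"
      by (rule aux[OF f1]) (use pos[of "q * u"] pos[of u] q u in auto)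
  qed
qed

lemma hstrips_shape: "shape a \<Longrightarrow> b \<in> hstrips a \<Longrightarrow> shape b"
proof -
  assume a: "shape a" and b: "b \<in> hstrips a"
  have "b (Suc i) \<le> b i" for i
  proof (cases "Suc i < L")
    case True
    then have "b (Suc i) \<le> a (Suc i)" "a (Suc i) \<le> b i" using b by (auto simp: hstrips_def)
    then show ?thesis by simp
  next
    case False
    then show ?thesis using b by (simp add: hstrips_def)
  qed
  then show "shape b" using b by (auto simp: shape_def hstrips_def)
qed

lemma H_horizontal:
  assumes a: "shape a" and t: "t > 0"
  shows "(\<Sum>b\<in>hstrips a. q ^ size b * H t b) = H (q * t) a"
proof -
  define u where "u = t / q ^ (L - 1)"
  have u: "u > 0" using t q by (simp add: u_def)
  define Q where "Q = (\<Prod>s<L. q ^ s)"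
  define S where "S = (\<Sum>b\<in>hstrips a. q ^ size b * ((\<Prod>i<L. g u (beta b i)) * vdm (beta b)))"
  have Qrev: "(\<Prod>i<L. q ^ (L - 1 - i)) = Q"
    unfolding Q_def by (subst prod.nat_diff_reindex[symmetric]) simp
  \<comment> \<open>The staircase inside the beta numbers contributes the fixed power
    \<open>Q\<close>, and the shape contributes \<open>q ^ size b\<close>.\<close>
  have qb: "(\<Prod>i<L. q ^ beta b i) = q ^ size b * Q" for b
    unfolding beta_def power_add prod.distrib Qrev by (simp add: size_def power_sum)
  \<comment> \<open>Absorbing \<open>Q\<close> and reversing the order of the factors gives the same
    constant as for vertical strips.\<close>
  have PQ: "(\<Prod>s<L. (u + 1 / q ^ s) / (1 + u)) * Q = (\<Prod>s<L. (1 + t / q ^ s) / (1 + u))"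
  proof -
    have "(u + 1 / q ^ s) * q ^ s = 1 + u * q ^ s" for s using q by (simp add: distrib_right)
    then have "(\<Prod>s<L. (u + 1 / q ^ s) / (1 + u)) * Q = (\<Prod>s<L. (1 + u * q ^ s) / (1 + u))"
      unfolding Q_def prod.distrib[symmetric] by (simp only: times_divide_eq_left)
    also have "\<dots> = (\<Prod>s<L. (1 + u * q ^ (L - Suc s)) / (1 + u))"
      by (rule prod.nat_diff_reindex[symmetric])
    also have "\<dots> = (\<Prod>s<L. (1 + t / q ^ s) / (1 + u))"
    proof (intro prod.cong refl)
      fix s assume "s \<in> {..<L}"
      then have "u * q ^ (L - Suc s) = t / q ^ s"
        using q by (auto simp: u_def field_simps power_add[symmetric])
      then show "(1 + u * q ^ (L - Suc s)) / (1 + u) = (1 + t / q ^ s) / (1 + u)" by simp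
    qed
    finally show ?thesis .
  qed
  have "(\<Sum>b\<in>hstrips a. (\<Prod>i<L. g u (beta b i) * q ^ beta b i) * vdm (beta b)) = Q * S"
    unfolding S_def sum_distrib_left prod.distrib qb by (simp add: mult_ac)
  with horizontal_box_sum[OF u a]
  have *: "(\<Prod>s<L. (1 + t / q ^ s) / (1 + u)) * S = (\<Prod>i<L. g (q * u) (beta a i)) * vdm (beta a)"
    unfolding PQ[symmetric] by simp
  have "(\<Sum>b\<in>hstrips a. q ^ size b * H t b) = H_const t * S"
    unfolding S_def sum_distrib_left
    using H_eq[OF hstrips_shape[OF a] t] by (intro sum.cong refl) (simp add: u_def mult_ac)
  also have "\<dots> = H_const (q * t) * ((\<Prod>s<L. (1 + t / q ^ s) / (1 + u)) * S)"
    unfolding H_const_shift[OF t, symmetric] u_def by simp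
  also have "\<dots> = H (q * t) a"
    unfolding * using t q by (subst H_eq[OF a]) (simp_all add: u_def)
  finally show ?thesis .
qed

lemma H_vertical:
  assumes a: "shape a" and t: "t > 0"
  shows "(\<Sum>b\<in>vstrips a. t ^ (size a - size b) * H (q * t) b) = H t a"
proof - \<comment> \<open>a choice of removed cells that leaves no partition makes two beta numbers equal, so its determinant vanishes\<close>
  define u where "u = t / q ^ (L - 1)"
  have u: "u > 0" and tu: "t = u * q ^ (L - 1)" using t q by (simp_all add: u_def)
  define F where "F l = (\<Prod>i<L. t ^ (beta a i - l i) * g (q * u) (l i)) * vdm l" for l
  let ?B = "{l. (\<forall>i<L. l i \<in> {beta a i - 1..beta a i}) \<and> (\<forall>i\<ge>L. l i = 0)}"
  let ?S = "{l\<in>?B. \<forall>i. Suc i < L \<longrightarrow> l (Suc i) < l i}"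
  let ?f = "\<lambda>b i. if i < L then beta b i else 0"
  have "(\<Sum>l\<in>?B. F l) = (\<Sum>l\<in>?S. F l)"
  proof (rule sum.mono_neutral_right)
    show "finite ?B" by (rule finite_box) auto
    show "\<forall>l\<in>?B - ?S. F l = 0"
    proof
      fix l assume l: "l \<in> ?B - ?S"
      then obtain i where i: "Suc i < L" "l i \<le> l (Suc i)" by auto
      have "l (Suc i) \<le> beta a (Suc i)" using l i by auto
      also have "\<dots> \<le> beta a i - 1" using beta_less[OF a lessI i(1)] by simp
      also have "\<dots> \<le> l i" using l i Suc_lessD[OF i(1)] by auto
      finally have "l i = l (Suc i)" using i by simp
      then have "vdm l = 0" using i by (intro vdm_eq_0[of i "Suc i"]) auto
      then show "F l = 0" by (simp add: F_def)
    qed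
  qed auto
  also have "\<dots> = (\<Sum>b\<in>vstrips a. F (?f b))"
  proof (rule sum.reindex_bij_witness[where j = "\<lambda>l i. l i - (L - 1 - i)" and i = ?f])
    fix l assume l: "l \<in> ?S"
    then have ge: "L - 1 - i \<le> l i" if "i < L" for i by (intro strict_ge) (use that in auto)
    show eq: "?f (\<lambda>i. l i - (L - 1 - i)) = l"
    proof
      fix i show "?f (\<lambda>i. l i - (L - 1 - i)) i = l i"
        using ge[of i] l by (cases "i < L") (simp_all only: beta_def if_True if_False le_add_diff_inverse2, simp)
    qed
    show "(\<lambda>i. l i - (L - 1 - i)) \<in> vstrips a"
      unfolding vstrips_def mem_Collect_eq
    proof (intro conjI allI)
      show "shape (\<lambda>i. l i - (L - 1 - i))"
        unfolding shape_def
      proof (intro conjI allI impI)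
        fix i show "l (Suc i) - (L - 1 - Suc i) \<le> l i - (L - 1 - i)"
        proof (cases "Suc i < L")
          case True
          then have "l (Suc i) < l i" "L - 1 - i = Suc (L - 1 - Suc i)" using l by auto
          then show ?thesis by simp
        next
          case False
          then show ?thesis using l by auto
        qed
      qed (use l in auto)
      fix i
      have bd: "beta a i - 1 \<le> l i" "l i \<le> beta a i" if "i < L" using l that by auto
      show "l i - (L - 1 - i) \<le> a i" using bd l by (cases "i < L") (auto simp: beta_def)
      show "a i \<le> Suc (l i - (L - 1 - i))" using bd l a by (cases "i < L") (auto simp: beta_def shape_def)
    qed
    show "F (?f (\<lambda>i. l i - (L - 1 - i))) = F l" unfolding eq ..
  next
    fix b assume b: "b \<in> vstrips a"
    show "(\<lambda>i. ?f b i - (L - 1 - i)) = b"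
      using b by (auto simp: beta_def fun_eq_iff vstrips_def shape_def)
    have "b i \<le> a i" "a i \<le> Suc (b i)" for i using b by (auto simp: vstrips_def)
    from this[of i for i] have "beta a i - 1 \<le> beta b i \<and> beta b i \<le> beta a i" for i
      unfolding beta_def by (metis add_le_mono1 diff_Suc_1 diff_le_mono add_Suc)
    moreover have "beta b (Suc i) < beta b i" if "Suc i < L" for i
      using b that by (intro beta_less) (auto simp: vstrips_def)
    ultimately show "?f b \<in> ?S" by auto
  qed
  also have "\<dots> = (\<Sum>b\<in>vstrips a. t ^ (size a - size b) * ((\<Prod>i<L. g (q * u) (beta b i)) * vdm (beta b)))"
  proof (rule sum.cong[OF refl])
    fix b assume b: "b \<in> vstrips a"
    have "vdm (?f b) = vdm (beta b)"
      unfolding vdm_def by (rule arg_cong[where f = det], rule cong_mat) auto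
    moreover have "(\<Prod>i<L. t ^ (beta a i - beta b i)) = t ^ (size a - size b)"
      using b by (simp add: power_sum[symmetric] beta_def size_def sum_subtractf_nat vstrips_def)
    ultimately show "F (?f b) = t ^ (size a - size b) * ((\<Prod>i<L. g (q * u) (beta b i)) * vdm (beta b))"
      by (simp add: F_def prod.distrib)
  qed
  finally have *: "(\<Prod>s<L. (1 + t / q ^ s) / (1 + u)) * ((\<Prod>i<L. g u (beta a i)) * vdm (beta a))
     = (\<Sum>b\<in>vstrips a. t ^ (size a - size b) * ((\<Prod>i<L. g (q * u) (beta b i)) * vdm (beta b)))"
    using vertical_box_sum[OF u tu, of "beta a"] by (simp add: F_def)
  have "(\<Sum>b\<in>vstrips a. t ^ (size a - size b) * H (q * t) b)
     = H_const (q * t) * (\<Sum>b\<in>vstrips a. t ^ (size a - size b) * ((\<Prod>i<L. g (q * u) (beta b i)) * vdm (beta b)))"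
    unfolding sum_distrib_left
  proof (rule sum.cong[OF refl])
    fix b assume "b \<in> vstrips a"
    then have "shape b" by (auto simp: vstrips_def)
    then show "t ^ (size a - size b) * H (q * t) b
      = H_const (q * t) * (t ^ (size a - size b) * ((\<Prod>i<L. g (q * u) (beta b i)) * vdm (beta b)))"
      using t q by (subst H_eq) (simp_all add: u_def)
  qed
  also have "\<dots> = H t a"
    unfolding *[symmetric] H_eq[OF a t] H_const_shift[OF t, symmetric] by (simp add: u_def mult_ac)
  finally show ?thesis .
qed

section \<open>The recursion for the generating functions\<close>

text \<open>Without a descent, positive cells are stripped backwards with weakly increasing row
  index and negative ones with strictly decreasing row index. The bound \<open>r\<close>, here and
  in \<open>vstrips_above\<close>, records the rows still available.\<close>

definition hstrips_from :: "(nat \<Rightarrow> nat) \<Rightarrow> nat \<Rightarrow> (nat \<Rightarrow> nat) set" where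
  "hstrips_from a r = {b\<in>hstrips a. \<forall>i<r. b i = a i}"

definition vstrips_above :: "(nat \<Rightarrow> nat) \<Rightarrow> nat \<Rightarrow> (nat \<Rightarrow> nat) set" where
  "vstrips_above a r = {b\<in>vstrips a. \<forall>i\<ge>r. b i = a i}"

lemma finite_hstrips_from: "finite (hstrips_from a r)"
proof -
  have "finite (hstrips a)" unfolding hstrips_def by (rule finite_box) auto
  then show ?thesis by (simp add: hstrips_from_def)
qed

lemma finite_vstrips_above: "finite (vstrips_above a r)"
proof -
  have "finite {b. (\<forall>i<L. b i \<in> {..a i}) \<and> (\<forall>i\<ge>L. b i = 0)}" by (rule finite_box) auto
  then show ?thesis
    by (rule rev_finite_subset) (auto simp: vstrips_above_def vstrips_def shape_def)
qed

lemma hstrips_from_dec_row: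
  assumes "j \<in> corner_rows a" "b \<in> hstrips_from (dec_row a j) j"
  shows "b j < a j" "i < j \<Longrightarrow> b i = a i"
proof -
  have "a j > 0" using assms(1) by (simp add: corner_rows_def)
  moreover have "b j \<le> a j - 1 \<or> b j = 0"
    using assms(2) by (cases "j < L") (auto simp: hstrips_from_def hstrips_def dec_row_def)
  ultimately show "b j < a j" by auto
  show "i < j \<Longrightarrow> b i = a i" using assms(2) by (auto simp: hstrips_from_def dec_row_def)
qed

text \<open>A nonempty strip is sorted by its topmost row \<open>j\<close>: the last cell of that
  row goes first, and the others form a strip in rows from \<open>j\<close> on.\<close>

lemma hstrips_from_decomp:
  assumes a: "shape a"
  shows "hstrips_from a r = insert a (\<Union>j\<in>{j\<in>corner_rows a. r \<le> j}. hstrips_from (dec_row a j) j)" (is "?A = ?B")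
proof (intro equalityI subsetI)
  fix b assume b: "b \<in> ?A"
  show "b \<in> ?B"
  proof (cases "b = a")
    case False
    then have ex: "\<exists>j. b j \<noteq> a j" by auto
    define j where "j = (LEAST j. b j \<noteq> a j)"
    have j: "b j \<noteq> a j" unfolding j_def using ex by (rule LeastI_ex)
    have below: "b i = a i" if "i < j" for i using not_less_Least[of i "\<lambda>j. b j \<noteq> a j"] that by (auto simp: j_def)
    have mono: "a (Suc i) \<le> a i" for i using a by (simp add: shape_def)
    have jL: "j < L" using j b a by (cases "j < L") (auto simp: hstrips_from_def hstrips_def shape_def)
    then have bj: "a (Suc j) \<le> b j" "b j < a j"
      using b j by (auto simp: hstrips_from_def hstrips_def order.strict_iff_order)
    have "j \<in> corner_rows a" "r \<le> j"
      using bj b j by (auto simp: corner_rows_def hstrips_from_def not_less[symmetric])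
    moreover have "b \<in> hstrips_from (dec_row a j) j"
      using b bj below jL mono[of "j - 1"] by (auto simp: hstrips_from_def hstrips_def dec_row_def)
    ultimately show ?thesis by blast
  qed auto
next
  fix b assume "b \<in> ?B"
  then consider "b = a" | j where "j \<in> corner_rows a" "r \<le> j" "b \<in> hstrips_from (dec_row a j) j" by auto
  then show "b \<in> ?A"
  proof cases
    case 1
    then show ?thesis using a by (auto simp: hstrips_from_def hstrips_def shape_def)
  next
    case 2
    have jL: "j < L" using corner_rows_less[OF a 2(1)] .
    have "b i \<in> {a (Suc i)..a i}" if "i < L" for i
    proof -
      have le: "a (Suc i) \<le> a i" using a by (auto simp: shape_def)
      consider "i < j" | "i = j" | "j < i" by linarith
      then show ?thesis
      proof cases
        case 1
        then show ?thesis using hstrips_from_dec_row(2)[OF 2(1) 2(3), of i] le by simp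
      next
        case 2
        then show ?thesis using \<open>b \<in> hstrips_from (dec_row a j) j\<close> that by (auto simp: hstrips_from_def hstrips_def dec_row_def)
      next
        case 3
        then show ?thesis using \<open>b \<in> hstrips_from (dec_row a j) j\<close> that by (auto simp: hstrips_from_def hstrips_def dec_row_def)
      qed
    qed
    moreover have "\<forall>i\<ge>L. b i = 0" using 2 by (auto simp: hstrips_from_def hstrips_def)
    ultimately show ?thesis
      using hstrips_from_dec_row(2)[OF 2(1) 2(3)] 2(2) by (auto simp: hstrips_from_def hstrips_def)
  qed
qed

lemma vstrips_above_dec_row:
  assumes "j \<in> corner_rows a" "b \<in> vstrips_above (dec_row a j) j"
  shows "b j < a j" "j < i \<Longrightarrow> b i = a i"
  using assms by (auto simp: vstrips_above_def dec_row_def corner_rows_def)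

text \<open>Here a nonempty strip is sorted by its lowest row \<open>j\<close>; that row loses a
  single cell, so the rest lies strictly above it.\<close>

lemma vstrips_above_decomp:
  assumes a: "shape a"
  shows "vstrips_above a r = insert a (\<Union>j\<in>{j\<in>corner_rows a. j < r}. vstrips_above (dec_row a j) j)" (is "?A = ?B")
proof (intro equalityI subsetI)
  fix b assume b: "b \<in> ?A"
  then have le: "b i \<le> a i" "a i \<le> Suc (b i)" for i by (auto simp: vstrips_above_def vstrips_def)
  have sb: "shape b" using b by (auto simp: vstrips_above_def vstrips_def)
  show "b \<in> ?B"
  proof (cases "b = a")
    case False
    define D where "D = {j. b j \<noteq> a j}"
    have D: "D \<noteq> {}" using False by (auto simp: D_def)
    have "D \<subseteq> {..<L}"
    proof
      fix i assume "i \<in> D"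
      then show "i \<in> {..<L}" using a sb by (cases "i < L") (auto simp: D_def shape_def)
    qed
    then have fin: "finite D" using finite_subset by blast
    define j where "j = Max D"
    have j: "b j \<noteq> a j" using Max_in[OF fin D] by (simp add: j_def D_def)
    have above: "b i = a i" if "i > j" for i
      using Max_ge[OF fin, of i] that by (auto simp: j_def D_def)
    have bj: "Suc (b j) = a j" using le[of j] j by simp
    have "b (Suc j) \<le> b j" using sb by (auto simp: shape_def)
    then have "j \<in> corner_rows a" "j < r"
      using bj b j above[of "Suc j"] by (auto simp: corner_rows_def vstrips_above_def not_le[symmetric])
    moreover have "b \<in> vstrips_above (dec_row a j) j"
      using le above bj sb by (auto simp: vstrips_above_def vstrips_def dec_row_def order.order_iff_strict)
    ultimately show ?thesis by blast
  qed auto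
next
  fix b assume "b \<in> ?B"
  then consider "b = a" | j where "j \<in> corner_rows a" "j < r" "b \<in> vstrips_above (dec_row a j) j" by auto
  then show "b \<in> ?A"
  proof cases
    case 1
    then show ?thesis using a by (auto simp: vstrips_above_def vstrips_def)
  next
    case 2
    have "b i \<le> a i \<and> a i \<le> Suc (b i)" for i
    proof -
      have "b i \<le> dec_row a j i" "dec_row a j i \<le> Suc (b i)" "b j = dec_row a j j"
        using 2 by (auto simp: vstrips_above_def vstrips_def)
      then show ?thesis by (cases "i = j") (auto simp: dec_row_def)
    qed
    then show ?thesis using 2 vstrips_above_dec_row(2)[OF 2(1) 2(3)]
      by (auto simp: vstrips_above_def vstrips_def)
  qed
qed

text \<open>The pieces of the decomposition are disjoint because \<open>j\<close> is recovered from
  \<open>b\<close> as the first row that differs from \<open>a\<close>.\<close>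

lemma sum_hstrips_from:
  assumes a: "shape a"
  shows "(\<Sum>b\<in>hstrips_from a r. F b) =
    F a + (\<Sum>j\<in>{j\<in>corner_rows a. r \<le> j}. \<Sum>b\<in>hstrips_from (dec_row a j) j. F b :: real)"
proof -
  have "(\<Sum>b\<in>(\<Union>j\<in>{j\<in>corner_rows a. r \<le> j}. hstrips_from (dec_row a j) j). F b)
    = (\<Sum>j\<in>{j\<in>corner_rows a. r \<le> j}. \<Sum>b\<in>hstrips_from (dec_row a j) j. F b)"
  proof (rule sum.UNION_disjoint)
    show "\<forall>i\<in>{j\<in>corner_rows a. r \<le> j}. \<forall>j\<in>{j\<in>corner_rows a. r \<le> j}. i \<noteq> j \<longrightarrow>
      hstrips_from (dec_row a i) i \<inter> hstrips_from (dec_row a j) j = {}"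
    proof (intro ballI impI)
      fix i j assume ij: "i \<in> {j\<in>corner_rows a. r \<le> j}" "j \<in> {j\<in>corner_rows a. r \<le> j}" "i \<noteq> j"
      show "hstrips_from (dec_row a i) i \<inter> hstrips_from (dec_row a j) j = {}"
      proof (rule ccontr)
        assume "hstrips_from (dec_row a i) i \<inter> hstrips_from (dec_row a j) j \<noteq> {}"
        then obtain b where b: "b \<in> hstrips_from (dec_row a i) i" "b \<in> hstrips_from (dec_row a j) j" by blast
        from ij(3) consider "i < j" | "j < i" by linarith
        then show False
          using hstrips_from_dec_row[OF _ b(1)] hstrips_from_dec_row[OF _ b(2)] ij(1,2) by cases fastforce+
      qed
    qed
  qed (auto simp: finite_hstrips_from finite_corner_rows[OF a])
  moreover have "a \<notin> (\<Union>j\<in>{j\<in>corner_rows a. r \<le> j}. hstrips_from (dec_row a j) j)"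
    using hstrips_from_dec_row(1)[of _ a a] by auto
  ultimately show ?thesis
    unfolding hstrips_from_decomp[OF a, of r]
    by (subst sum.insert) (auto simp: finite_hstrips_from finite_corner_rows[OF a])
qed

lemma sum_vstrips_above:
  assumes a: "shape a"
  shows "(\<Sum>b\<in>vstrips_above a r. F b) =
    F a + (\<Sum>j\<in>{j\<in>corner_rows a. j < r}. \<Sum>b\<in>vstrips_above (dec_row a j) j. F b :: real)"
proof -
  have "(\<Sum>b\<in>(\<Union>j\<in>{j\<in>corner_rows a. j < r}. vstrips_above (dec_row a j) j). F b)
    = (\<Sum>j\<in>{j\<in>corner_rows a. j < r}. \<Sum>b\<in>vstrips_above (dec_row a j) j. F b)"
  proof (rule sum.UNION_disjoint)
    show "\<forall>i\<in>{j\<in>corner_rows a. j < r}. \<forall>j\<in>{j\<in>corner_rows a. j < r}. i \<noteq> j \<longrightarrow>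
      vstrips_above (dec_row a i) i \<inter> vstrips_above (dec_row a j) j = {}"
    proof (intro ballI impI)
      fix i j assume ij: "i \<in> {j\<in>corner_rows a. j < r}" "j \<in> {j\<in>corner_rows a. j < r}" "i \<noteq> j"
      show "vstrips_above (dec_row a i) i \<inter> vstrips_above (dec_row a j) j = {}"
      proof (rule ccontr)
        assume "vstrips_above (dec_row a i) i \<inter> vstrips_above (dec_row a j) j \<noteq> {}"
        then obtain b where b: "b \<in> vstrips_above (dec_row a i) i" "b \<in> vstrips_above (dec_row a j) j" by blast
        from ij(3) consider "i < j" | "j < i" by linarith
        then show False
          using vstrips_above_dec_row[OF _ b(1)] vstrips_above_dec_row[OF _ b(2)] ij(1,2) by cases fastforce+
      qed
    qed
  qed (auto simp: finite_vstrips_above finite_corner_rows[OF a])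
  moreover have "a \<notin> (\<Union>j\<in>{j\<in>corner_rows a. j < r}. vstrips_above (dec_row a j) j)"
    using vstrips_above_dec_row(1)[of _ a a] by auto
  ultimately show ?thesis
    unfolding vstrips_above_decomp[OF a, of r]
    by (subst sum.insert) (auto simp: finite_vstrips_above finite_corner_rows[OF a])
qed

section \<open>Induction on the size\<close>

lemma H_zero: "H t (\<lambda>_. 0) = 1"
proof -
  \<comment> \<open>For the empty shape the beta numbers are the staircase, so the differences
    \<open>j - i\<close> produce the very factors \<open>qp\<close> of the denominators.\<close>
  have "(\<Prod>j<L. \<Prod>i<j. 1 - q ^ (beta (\<lambda>_. 0) i - beta (\<lambda>_. 0) j)) = (\<Prod>j<L. qp j)"
  proof (rule prod.cong[OF refl])
    fix j assume "j \<in> {..<L}"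
    then have "(\<Prod>i<j. 1 - q ^ (beta (\<lambda>_. 0) i - beta (\<lambda>_. 0) j)) = (\<Prod>i<j. 1 - q ^ Suc (j - Suc i))"
      by (intro prod.cong refl) (auto simp: beta_def intro!: arg_cong[where f = "power q"] simp del: power_Suc)
    also have "\<dots> = qp j" unfolding qp_def by (rule prod.nat_diff_reindex)
    finally show "(\<Prod>i<j. 1 - q ^ (beta (\<lambda>_. 0) i - beta (\<lambda>_. 0) j)) = qp j" .
  qed
  also have "\<dots> = (\<Prod>i<L. qp (L - Suc i))" by (rule prod.nat_diff_reindex[symmetric])
  finally show ?thesis
    by (simp add: H_def beta_def prod_dividef)
qed

lemma qp_Suc: "qp (Suc n) = qp n * (1 - q ^ Suc n)"
  by (simp add: qp_def)

lemma sum_corner_signs: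
  assumes "shape a"
  shows "(\<Sum>y\<in>corner_rows a \<times> (UNIV :: bool set). F y) = (\<Sum>j\<in>corner_rows a. F (j, False)) + (\<Sum>j\<in>corner_rows a. F (j, True) :: real)"
proof -
  have "(\<Sum>y\<in>corner_rows a \<times> (UNIV :: bool set). F y) = (\<Sum>j\<in>corner_rows a. \<Sum>s\<in>UNIV. F (j, s))"
    using finite_corner_rows[OF assms] by (subst sum.cartesian_product) auto
  then show ?thesis by (simp add: UNIV_bool sum.distrib add.commute)
qed

text \<open>
  The factor \<open>1 - q ^ n\<close> is what is left, where there is no descent, after splitting off the term with
  \<open>q ^ n\<close> for every predecessor; thus the final descent-free block either stops here or continues.
\<close>

lemma last_gf_Suc:
  assumes "i \<in> corner_rows a" "shape a"
  shows "last_gf q t (Suc n) a (i, s) = (if s then t else 1) *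
    (q ^ n * total_gf q t n (dec_row a i) +
      (\<Sum>j\<in>{j\<in>corner_rows (dec_row a i). \<not> desc (j, False) (i, s)}. (1 - q ^ n) * last_gf q t n (dec_row a i) (j, False)) +
      (\<Sum>j\<in>{j\<in>corner_rows (dec_row a i). \<not> desc (j, True) (i, s)}. (1 - q ^ n) * last_gf q t n (dec_row a i) (j, True)))"
proof -
  let ?c = "dec_row a i"
  note sh = shape_dec_row[OF assms(2,1)]
  have "(\<Sum>y\<in>corner_rows ?c \<times> UNIV. (if desc y (i, s) then q ^ n else 1) * last_gf q t n ?c y)
    = (\<Sum>y\<in>corner_rows ?c \<times> UNIV. q ^ n * last_gf q t n ?c y + (if \<not> desc y (i, s) then (1 - q ^ n) * last_gf q t n ?c y else 0))"
    by (intro sum.cong refl) (simp add: algebra_simps)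
  also have "\<dots> = q ^ n * (\<Sum>y\<in>corner_rows ?c \<times> UNIV. last_gf q t n ?c y) +
      ((\<Sum>j\<in>{j\<in>corner_rows ?c. \<not> desc (j, False) (i, s)}. (1 - q ^ n) * last_gf q t n ?c (j, False)) +
      (\<Sum>j\<in>{j\<in>corner_rows ?c. \<not> desc (j, True) (i, s)}. (1 - q ^ n) * last_gf q t n ?c (j, True)))"
    unfolding sum.distrib sum_distrib_left sum_corner_signs[OF sh]
    by (simp add: sum.inter_filter[OF finite_corner_rows[OF sh]] sum_distrib_left distrib_left)
  finally show ?thesis
    by (cases "n = 0") (simp_all add: total_gf_def)
qed

text \<open>The induction carries along both signs of the largest entry. If it is positive, only a
  horizontal strip is removed, and \<open>q ^ size b\<close> comes from stopping at
  \<open>b\<close>. If it is negative, a vertical strip comes first, and the horizontal strips after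
  it are already summed to \<open>H (q * t) b\<close>.\<close>

lemma total_gf_eq_H:
  assumes t: "t > 0"
  shows "shape a \<Longrightarrow> size a = n \<Longrightarrow> total_gf q t n a = qp n * H t a"
proof -
  have "\<forall>a. shape a \<longrightarrow> size a = n \<longrightarrow> total_gf q t n a = qp n * H t a \<and>
     (\<forall>i\<in>corner_rows a.
        (1 - q ^ n) * last_gf q t n a (i, False) = qp n * (\<Sum>b\<in>hstrips_from (dec_row a i) i. q ^ size b * H t b) \<and>
        (1 - q ^ n) * last_gf q t n a (i, True) = qp n * (\<Sum>b\<in>vstrips_above (dec_row a i) i. t ^ (n - size b) * H (q * t) b))"
  proof (induction n)
    case 0
    show ?case
    proof (intro allI impI conjI ballI)
      fix a assume a: "shape a" "size a = 0"
      then have "a = (\<lambda>_. 0)" by (auto simp: size_def shape_def fun_eq_iff not_less[symmetric])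
      then show "total_gf q t 0 a = qp 0 * H t a" by (simp add: total_gf_def H_zero qp_def)
      fix i assume "i \<in> corner_rows a"
      then show "(1 - q ^ 0) * last_gf q t 0 a (i, False) = qp 0 * (\<Sum>b\<in>hstrips_from (dec_row a i) i. q ^ size b * H t b)"
        "(1 - q ^ 0) * last_gf q t 0 a (i, True) = qp 0 * (\<Sum>b\<in>vstrips_above (dec_row a i) i. t ^ (0 - size b) * H (q * t) b)"
        using size_dec_row[OF a(1)] a(2) by auto
    qed
  next
    case (Suc n)
    have hor: "(\<Sum>b\<in>hstrips_from a 0. q ^ size b * H t b) = H (q * t) a" if "shape a" for a
      using H_horizontal[OF that t] by (simp add: hstrips_from_def)
    have ver: "(\<Sum>b\<in>vstrips_above a L. t ^ (size a - size b) * H (q * t) b) = H t a" if "shape a" for a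
    proof -
      have "vstrips_above a L = vstrips a" using that by (auto simp: vstrips_above_def vstrips_def shape_def)
      then show ?thesis using H_vertical[OF that t] by simp
    qed
    show ?case
    proof (intro allI impI)
      fix a assume a: "shape a" "size a = Suc n"
      have last: "last_gf q t (Suc n) a (i, False) = qp n * (\<Sum>b\<in>hstrips_from (dec_row a i) i. q ^ size b * H t b) \<and>
        last_gf q t (Suc n) a (i, True) = qp n * (\<Sum>b\<in>vstrips_above (dec_row a i) i. t ^ (Suc n - size b) * H (q * t) b)"
        if i: "i \<in> corner_rows a" for i
      proof -
        let ?c = "dec_row a i"
        have c: "shape ?c" "size ?c = n" using shape_dec_row[OF a(1) i] size_dec_row[OF a(1) i] a(2) by auto
        note IH = Suc[rule_format, OF c]
        have tot: "total_gf q t n ?c = qp n * H t ?c" using IH by blast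
        \<comment> \<open>The subtracted term is the empty strip; it is restored by the summand
          \<open>q ^ n * total_gf\<close> of \<open>last_gf_Suc\<close>.\<close>
        have plus: "(\<Sum>j\<in>{j\<in>corner_rows ?c. r \<le> j}. (1 - q ^ n) * last_gf q t n ?c (j, False))
          = qp n * ((\<Sum>b\<in>hstrips_from ?c r. q ^ size b * H t b) - q ^ n * H t ?c)" for r
          using IH unfolding sum_hstrips_from[OF c(1), of _ r] by (simp add: c(2) sum_distrib_left)
        have minus: "(\<Sum>j\<in>{j\<in>corner_rows ?c. j < r}. (1 - q ^ n) * last_gf q t n ?c (j, True))
          = qp n * ((\<Sum>b\<in>vstrips_above ?c r. t ^ (n - size b) * H (q * t) b) - H (q * t) ?c)" for r
          using IH unfolding sum_vstrips_above[OF c(1), of _ r] by (simp add: c(2) sum_distrib_left)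
        \<comment> \<open>A negative entry directly before a positive one always makes a descent, a
          positive one before a negative one never does. So the third set is unrestricted, and its
          full horizontal sum \<open>H (q * t)\<close> supplies the empty strip missing in
          \<open>minus\<close>.\<close>
        have "{j \<in> corner_rows ?c. \<not> desc (j, False) (i, False)} = {j \<in> corner_rows ?c. i \<le> j}"
          "{j \<in> corner_rows ?c. \<not> desc (j, True) (i, False)} = {}"
          "{j \<in> corner_rows ?c. \<not> desc (j, False) (i, True)} = {j \<in> corner_rows ?c. 0 \<le> j}"
          "{j \<in> corner_rows ?c. \<not> desc (j, True) (i, True)} = {j \<in> corner_rows ?c. j < i}"
          by (auto simp: desc_def)
        note sets = this
        have "last_gf q t (Suc n) a (i, False) = qp n * (\<Sum>b\<in>hstrips_from ?c i. q ^ size b * H t b)"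
          unfolding last_gf_Suc[OF i a(1)] sets tot plus by (simp add: algebra_simps)
        moreover have "last_gf q t (Suc n) a (i, True) = t * (qp n * (\<Sum>b\<in>vstrips_above ?c i. t ^ (n - size b) * H (q * t) b))"
          unfolding last_gf_Suc[OF i a(1)] sets tot plus minus hor[OF c(1)] by (simp add: algebra_simps)
        moreover have "t * t ^ (n - size b) = t ^ (Suc n - size b)" if "b \<in> vstrips_above ?c i" for b
        proof -
          have "size b \<le> size ?c" unfolding size_def using that by (intro sum_mono) (auto simp: vstrips_above_def vstrips_def)
          then show ?thesis using c(2) by (simp add: Suc_diff_le)
        qed
        from this[symmetric] have "t * (qp n * (\<Sum>b\<in>vstrips_above ?c i. t ^ (n - size b) * H (q * t) b))
          = qp n * (\<Sum>b\<in>vstrips_above ?c i. t ^ (Suc n - size b) * H (q * t) b)"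
          unfolding sum_distrib_left by (intro sum.cong refl) (simp add: mult.assoc[symmetric] mult.commute[of t])
        ultimately show ?thesis by simp
      qed
      have "{j \<in> corner_rows a. 0 \<le> j} = corner_rows a" "{j \<in> corner_rows a. j < L} = corner_rows a"
        using corner_rows_less[OF a(1)] by auto
      note sets = this
      have "total_gf q t (Suc n) a = (\<Sum>i\<in>corner_rows a. last_gf q t (Suc n) a (i, False)) + (\<Sum>i\<in>corner_rows a. last_gf q t (Suc n) a (i, True))"
        by (simp only: total_gf_def sum_corner_signs[OF a(1)]) simp
      also have "\<dots> = qp n * (\<Sum>i\<in>corner_rows a. \<Sum>b\<in>hstrips_from (dec_row a i) i. q ^ size b * H t b)
        + qp n * (\<Sum>i\<in>corner_rows a. \<Sum>b\<in>vstrips_above (dec_row a i) i. t ^ (Suc n - size b) * H (q * t) b)"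
        unfolding sum_distrib_left[of "qp n" _ "corner_rows a"] by (simp add: last del: last_gf.simps)
      \<comment> \<open>The terms \<open>H (q * t) a\<close> from the two signs cancel, which leaves
        the factor \<open>1 - q ^ Suc n\<close> of \<open>qp (Suc n)\<close>.\<close>
      also have "\<dots> = qp n * (H (q * t) a - q ^ Suc n * H t a) + qp n * (H t a - H (q * t) a)"
      proof -
        have "(\<Sum>i\<in>corner_rows a. \<Sum>b\<in>hstrips_from (dec_row a i) i. q ^ size b * H t b) = H (q * t) a - q ^ Suc n * H t a"
          using hor[OF a(1)] unfolding sum_hstrips_from[OF a(1), of _ 0] sets a(2) by simp
        moreover have "(\<Sum>i\<in>corner_rows a. \<Sum>b\<in>vstrips_above (dec_row a i) i. t ^ (Suc n - size b) * H (q * t) b) = H t a - H (q * t) a"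
          using ver[OF a(1)] unfolding sum_vstrips_above[OF a(1), of _ L] sets a(2) by simp
        ultimately show ?thesis by (simp only:)
      qed
      also have "\<dots> = qp (Suc n) * H t a" by (simp add: qp_Suc algebra_simps)
      finally show "total_gf q t (Suc n) a = qp (Suc n) * H t a \<and>
        (\<forall>i\<in>corner_rows a.
          (1 - q ^ Suc n) * last_gf q t (Suc n) a (i, False) = qp (Suc n) * (\<Sum>b\<in>hstrips_from (dec_row a i) i. q ^ size b * H t b) \<and>
          (1 - q ^ Suc n) * last_gf q t (Suc n) a (i, True) = qp (Suc n) * (\<Sum>b\<in>vstrips_above (dec_row a i) i. t ^ (Suc n - size b) * H (q * t) b))"
        using last by (simp add: qp_Suc mult_ac)
    qed
  qed
  then show "shape a \<Longrightarrow> size a = n \<Longrightarrow> total_gf q t n a = qp n * H t a" by blast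
qed

section \<open>Return from beta numbers to hook lengths\<close>

lemma H_eq_hooks:
  assumes a: "shape a"
  shows "H t a = (\<Prod>(r,c)\<in>cells (row_list a). (q ^ (r - 1) + t * q ^ (c - 1)) / (1 - q ^ hook (row_list a) (r, c)))"
proof -
  have "(\<Prod>j<L. \<Prod>i<j. 1 - q ^ (beta a i - beta a j)) = (\<Prod>j<L. \<Prod>i\<in>{i\<in>{..<L}. i < j}. 1 - q ^ (beta a i - beta a j))"
    by (intro prod.cong refl) auto
  also have "\<dots> = (\<Prod>i<L. \<Prod>j\<in>{j\<in>{..<L}. i < j}. 1 - q ^ (beta a i - beta a j))"
    by (rule prod.swap_restrict) auto
  also have "\<dots> = (\<Prod>i<L. \<Prod>j\<in>{i<..<L}. 1 - q ^ (beta a i - beta a j))"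
    by (intro prod.cong refl) auto
  \<comment> \<open>With the pairs grouped by their smaller index, \<open>prod_hooks_row\<close> for
    \<open>1 - q ^ k\<close> trades the differences of row \<open>i\<close> for its hooks; the
    \<open>qp\<close> then cancels against \<open>H_def\<close>.\<close>
  also have "\<dots> = (\<Prod>i<L. qp (beta a i) / (\<Prod>c<a i. 1 - q ^ hook (row_list a) (Suc i, Suc c)))"
  proof (rule prod.cong[OF refl])
    fix i assume "i \<in> {..<L}"
    then have eq: "(\<Prod>c<a i. 1 - q ^ hook (row_list a) (Suc i, Suc c)) * (\<Prod>j\<in>{i<..<L}. 1 - q ^ (beta a i - beta a j)) = qp (beta a i)"
      using prod_hooks_row[OF a, of i "\<lambda>k. 1 - q ^ k"]
      by (simp add: qp_def prod.atLeast1_atMost_eq)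
    then have "(\<Prod>c<a i. 1 - q ^ hook (row_list a) (Suc i, Suc c)) \<noteq> 0" using qp_nonzero[of "beta a i"] by (metis mult_zero_left)
    then show "(\<Prod>j\<in>{i<..<L}. 1 - q ^ (beta a i - beta a j)) = qp (beta a i) / (\<Prod>c<a i. 1 - q ^ hook (row_list a) (Suc i, Suc c))"
      unfolding eq[symmetric] by simp
  qed
  finally show ?thesis
    unfolding H_def prod_cells_row_list[OF a] by (simp add: prod_dividef)
qed

lemma signed_SYT_hook_real:
  assumes a: "shape a" and t: "t > 0"
  shows "(\<Sum>TN\<in>signed_SYT (row_list a). q ^ maj (row_list a) TN * t ^ neg TN) * (\<Prod>x\<in>cells (row_list a). qint q (hook (row_list a) x))
    = qfact q (size a) * (\<Prod>(r,c)\<in>cells (row_list a). q ^ (r - 1) + t * q ^ (c - 1))"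
proof -
  let ?l = "row_list a" and ?C = "cells (row_list a)"
  have qint: "1 - q ^ k = (1 - q) * qint q k" for k
    unfolding qint_def by (rule one_diff_power_eq)
  have hook_pos: "hook ?l x > 0" if "x \<in> ?C" for x
  proof -
    have "x = (Suc (fst x - 1), Suc (snd x - 1))" "snd x - 1 < a (fst x - 1)"
      using that by (cases x, auto simp: cells_row_list[OF a])+
    then show ?thesis by (metis add_gr_0 hook_row_list[OF a] zero_less_diff)
  qed
  have nz: "(\<Prod>x\<in>?C. 1 - q ^ hook ?l x) \<noteq> 0"
  proof -
    have "1 - q ^ hook ?l x \<noteq> 0" if "x \<in> ?C" for x
      using hook_pos[OF that] q_pow_less_1[of "hook ?l x - 1"] by simp
    moreover have "finite ?C" by (rule finite_cells)
    ultimately show ?thesis by simp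
  qed
  \<comment> \<open>The cells are counted by comparing exponents in the product of the constant 2
    over all of them.\<close>
  have "card ?C = size a"
    using prod_cells_row_list[OF a, of "\<lambda>_. 2 :: nat"] by (simp add: size_def power_sum[symmetric])
  then have hooks: "(\<Prod>x\<in>?C. 1 - q ^ hook ?l x) = (1 - q) ^ size a * (\<Prod>x\<in>?C. qint q (hook ?l x))"
    unfolding qint by (simp add: prod.distrib)
  have fact: "qp (size a) = (1 - q) ^ size a * qfact q (size a)"
    unfolding qp_def qint qfact_def by (simp add: prod.distrib prod.atLeast1_atMost_eq)
  have "(\<Sum>TN\<in>signed_SYT ?l. q ^ maj ?l TN * t ^ neg TN) * (\<Prod>x\<in>?C. 1 - q ^ hook ?l x)
    = qp (size a) * (\<Prod>(r,c)\<in>?C. q ^ (r - 1) + t * q ^ (c - 1))"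
    unfolding sum_signed_SYT_eq_total_gf[OF a] total_gf_eq_H[OF t a refl] H_eq_hooks[OF a]
    using nz by (simp add: prod_dividef case_prod_beta)
  then show ?thesis
    unfolding hooks fact using q by simp
qed

end

section \<open>Transfer to arbitrary rings\<close>

text \<open>The outer variable is sent to \<open>x\<close> and stands for \<open>q\<close>, the
  inner one is sent to \<open>y\<close> and stands for \<open>t\<close>.\<close>

definition eval2 :: "'a::comm_ring_1 \<Rightarrow> 'a \<Rightarrow> int poly poly \<Rightarrow> 'a" where
  "eval2 x y p = poly (map_poly (\<lambda>c. poly (map_poly of_int c) y) p) x"

lemma comm_ring_hom_eval_int: "comm_ring_hom (\<lambda>c. poly (map_poly (of_int :: int \<Rightarrow> 'a::comm_ring_1) c) y)"
proof -
  interpret h: map_poly_comm_ring_hom "of_int :: int \<Rightarrow> 'a" ..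
  show ?thesis by unfold_locales (simp_all add: hom_distribs)
qed

lemma comm_ring_hom_eval2: "comm_ring_hom (eval2 x (y :: 'a::comm_ring_1))"
proof -
  interpret c: comm_ring_hom "\<lambda>c. poly (map_poly (of_int :: int \<Rightarrow> 'a) c) y"
    by (rule comm_ring_hom_eval_int)
  interpret h: map_poly_comm_ring_hom "\<lambda>c. poly (map_poly (of_int :: int \<Rightarrow> 'a) c) y" ..
  show ?thesis by unfold_locales (simp_all add: eval2_def hom_distribs)
qed

lemma eval2_vars: "eval2 x (y :: 'a::comm_ring_1) [:0, 1:] = x" "eval2 x y [:[:0, 1:]:] = y"
  by (simp_all add: eval2_def map_poly_pCons)

text \<open>For fixed \<open>y\<close> the polynomial in \<open>x\<close> has infinitely many roots,
  so each coefficient vanishes at every positive \<open>y\<close> and is therefore zero as a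
  polynomial in \<open>y\<close>.\<close>

lemma eval2_eq_0_imp_eq_0:
  assumes "\<And>x y. 0 < x \<Longrightarrow> x < 1 \<Longrightarrow> 0 < y \<Longrightarrow> eval2 x (y::real) p = 0"
  shows "p = 0"
proof -
  have inf: "infinite {0<..<1::real}" by simp
  have zero: "r = 0" if "\<And>x. 0 < x \<Longrightarrow> x < 1 \<Longrightarrow> poly r x = 0" for r :: "real poly"
  proof (rule ccontr)
    assume "r \<noteq> 0"
    then have "finite {x. poly r x = 0}" by (rule poly_roots_finite)
    then have "finite {0<..<1::real}" by (rule rev_finite_subset) (use that in auto)
    then show False using inf by simp
  qed
  have "coeff p k = 0" for k
  proof -
    have "poly (map_poly of_int (coeff p k)) y = 0" if "0 < y" for y :: real
    proof -
      have "map_poly (\<lambda>c. poly (map_poly of_int c) y) p = 0"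
        by (rule zero) (use assms that in \<open>simp add: eval2_def\<close>)
      then have "coeff (map_poly (\<lambda>c. poly (map_poly of_int c) y) p) k = 0" by simp
      then show ?thesis by (simp add: coeff_map_poly)
    qed
    then have "map_poly (real_of_int) (coeff p k) = 0" by (intro zero) auto
    then show ?thesis by simp
  qed
  then show ?thesis by (simp add: poly_eq_iff)
qed

lemma (in row_bound) signed_SYT_hook_ring:
  fixes q t :: "'a::comm_ring_1"
  assumes a: "shape a"
  shows "(\<Sum>TN\<in>signed_SYT (row_list a). q ^ maj (row_list a) TN * t ^ neg TN) * (\<Prod>x\<in>cells (row_list a). qint q (hook (row_list a) x))
    = qfact q (size a) * (\<Prod>(r,c)\<in>cells (row_list a). q ^ (r - 1) + t * q ^ (c - 1))"
proof -
  let ?l = "row_list a"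
  define X :: "int poly poly" where "X = [:0, 1:]"
  define Y :: "int poly poly" where "Y = [:[:0, 1:]:]"
  define p where "p = (\<Sum>TN\<in>signed_SYT ?l. X ^ maj ?l TN * Y ^ neg TN) * (\<Prod>x\<in>cells ?l. qint X (hook ?l x))
    - qfact X (size a) * (\<Prod>(r,c)\<in>cells ?l. X ^ (r - 1) + Y * X ^ (c - 1))"
  have eval_p: "eval2 x y p =
      (\<Sum>TN\<in>signed_SYT ?l. x ^ maj ?l TN * y ^ neg TN) * (\<Prod>c\<in>cells ?l. qint x (hook ?l c))
    - qfact x (size a) * (\<Prod>(r,c)\<in>cells ?l. x ^ (r - 1) + y * x ^ (c - 1))" for x y :: "'b::comm_ring_1"
  proof -
    interpret e: comm_ring_hom "eval2 x y" by (rule comm_ring_hom_eval2)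
    have "eval2 x y X = x" "eval2 x y Y = y" by (simp_all add: X_def Y_def eval2_vars)
    then show ?thesis
      unfolding p_def qint_def qfact_def case_prod_beta by (simp add: hom_distribs)
  qed
  have "p = 0"
  proof (rule eval2_eq_0_imp_eq_0)
    fix x y :: real assume "0 < x" "x < 1" "0 < y"
    then interpret q_real L x by unfold_locales
    show "eval2 x y p = 0"
      unfolding eval_p using signed_SYT_hook_real[OF a \<open>0 < y\<close>] by simp
  qed
  interpret e: comm_ring_hom "eval2 q t" by (rule comm_ring_hom_eval2)
  show ?thesis using eval_p[of q t] \<open>p = 0\<close> by simp
qed

theorem theorem1p6:
  fixes lam :: "nat list" and n :: nat and q t :: "'a::field"
  assumes "is_partition lam n"
    and "\<forall>x\<in>cells lam. qint q (hook lam x) \<noteq> 0"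
  shows "(\<Sum>TN\<in>signed_SYT lam. q ^ maj lam TN * t ^ neg TN)
         = qfact q n * (\<Prod>(r, c)\<in>cells lam. (q ^ (r - 1) + t * q ^ (c - 1)) / qint q (hook lam (r, c)))"
proof -
  interpret row_bound "length lam" .
  \<comment> \<open>The list of parts is padded with zero rows to become a function on all row
    indices.\<close>
  define a where "a i = (if i < length lam then lam ! i else 0)" for i
  have lam: "row_list a = lam"
    by (rule nth_equalityI) (auto simp: a_def)
  have "sorted_wrt (\<ge>) lam" using assms(1) by (simp add: is_partition_def)
  then have "shape a" by (auto simp: shape_def a_def sorted_wrt_iff_nth_less)
  moreover have "size a = n" using sum_row_list[of a] assms(1) by (simp add: lam is_partition_def)
  moreover have "(\<Prod>x\<in>cells lam. qint q (hook lam x)) \<noteq> 0"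
    using assms(2) by (simp add: finite_cells)
  ultimately show ?thesis
    using signed_SYT_hook_ring[of a q t] by (simp add: lam prod_dividef case_prod_beta nonzero_eq_divide_eq)
qed

end
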